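(* Let $f\in V$ and let $\{\theta_m\}_{m\in\mathbb N}$ be a sequence of real numbers with $\theta_1\ge\theta_2\ge\cdots\ge0$ and $\lim_{m\to\infty}\theta_m=0$. Assume $\mathrm{var}_m(f)^{1/m}\le\theta_m$ for all $m\in\mathbb N$. Write $\mathcal B=\mathcal B(\{\theta_m\})$. Then: (i) $\mathscr L_f(\mathcal B)\subset\mathcal B$ and $\mathscr L_f:\mathcal B\to\mathcal B$ is a compact operator. (ii) $\Lambda_f=\sigma(\mathscr L_f:\mathcal B\to\mathcal B)\setminus\{0\}$, and for each $\lambda\in\Lambda_f$ the multiplicity of $\lambda$ as an eigenvalue of $\mathscr L_f:V\to V$ equals its multiplicity as an eigenvalue of $\mathscr L_f:\mathcal B\to\mathcal B$.
   Context: Let $N\ge2$ and let $\mathbf A$ be an $N\times N$ zero-one matrix that is aperiodic (some power $\mathbf A^k$, $k\ge1$, has all entries positive). Let $\Sigma_{\mathbf A}^+=\{\omega=(\omega_m)_{m\ge0}\in\{1,\dots,N\}^{\mathbb N\cup\{0\}}:\mathbf A(\omega_m\omega_{m+1})=1\ \forall m\ge0\}$ with the product topology, and $\sigma_{\mathbf A}$ the shift $(\sigma_{\mathbf A}\omega)_m=\omega_{m+1}$. For $\phi:\Sigma_{\mathbf A}^+\to\mathbb C$ and $m\ge0$ let $\mathrm{var}_m(\phi)=\sup|\phi(\omega)-\phi(\omega')|$, the sup over all $\omega,\omega'$ with $\omega_k=\omega'_k$ for $0\le k\le m-1$ (all pairs if $m=0$). $V$ is the set of $\phi:\Sigma_{\mathbf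 A}^+\to\mathbb C$ with $\mathrm{var}_m(\phi)^{1/m}\to0$ (super-continuous functions). For $\theta\in(0,1)$, $d_\theta(\omega,\omega')=\theta^{\min\{m:\omega_m\neq\omega'_m\}}$ ($0$ if $\omega=\omega'$), $F_\theta$ is the space of complex $d_\theta$-Lipschitz functions with norm $\|\phi\|_\theta=\|\phi\|_\infty+[\phi]_\theta$ ($[\phi]_\theta$ the Lipschitz constant); $V$ carries the locally convex topology generated by the norms $\|\cdot\|_\theta$, $\theta\in(0,1)$. For $f\in V$ the transfer operator is $(\mathscr L_f\phi)(\omega)=\sum_{\omega'\in\Sigma_{\mathbf A}^+:\sigma_{\mathbf A}\omega'=\omega}e^{f(\omega')}\phi(\omega')$, which maps $V$ into $V$. $\Lambda_f$ is the set of nonzero eigenvalues of $\mathscr L_f:V\to V$ (each has finite multiplicity). For such a sequence $\{\theta_m\}$, $\mathcal B(\{\theta_m\})=\{\phi\in V:\exists C\ge0,\ \mathrm{var}_m(\phi)\le C\theta_{m+1}^m\ \forall m\ge0\}$ (with the convention $\theta_1^0=1$), normed by $\|\phi\|_{\mathcal B}=\|\phi\|_\infty+\inf\{C\ge0:\mathrm{var}_m(\phi)\le C\theta_{m+1}^m\ \forall m\ge0\}$; it is a Banach space. $\sigma(T:E\to E)$ denotes the spectrum. *)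

theory Defs
  imports Complex_Main "HOL-Library.Extended_Real"
begin

(* Symbols are 1..N; the matrix A is a function nat => nat => nat, only its
   entries on {1..N} x {1..N} matter. *)

fun matpow :: "nat \<Rightarrow> (nat \<Rightarrow> nat \<Rightarrow> nat) \<Rightarrow> nat \<Rightarrow> nat \<Rightarrow> nat \<Rightarrow> nat" where
  "matpow N A 0 i j = (if i = j then 1 else 0)"
| "matpow N A (Suc k) i j = (\<Sum>l\<in>{1..N}. matpow N A k i l * A l j)"

definition zero_one_matrix :: "nat \<Rightarrow> (nat \<Rightarrow> nat \<Rightarrow> nat) \<Rightarrow> bool" where
  "zero_one_matrix N A \<longleftrightarrow> (\<forall>i\<in>{1..N}. \<forall>j\<in>{1..N}. A i j = 0 \<or> A i j = 1)"

definition aperiodic :: "nat \<Rightarrow> (nat \<Rightarrow> nat \<Rightarrow> nat) \<Rightarrow> bool" where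
  "aperiodic N A \<longleftrightarrow> (\<exists>k\<ge>1. \<forall>i\<in>{1..N}. \<forall>j\<in>{1..N}. matpow N A k i j > 0)"

definition SigmaA :: "nat \<Rightarrow> (nat \<Rightarrow> nat \<Rightarrow> nat) \<Rightarrow> (nat \<Rightarrow> nat) set" where
  "SigmaA N A = {w. (\<forall>m. w m \<in> {1..N}) \<and> (\<forall>m. A (w m) (w (Suc m)) = 1)}"

definition shift :: "(nat \<Rightarrow> nat) \<Rightarrow> (nat \<Rightarrow> nat)" where
  "shift w = (\<lambda>m. w (Suc m))"

(* functions on SigmaA are represented as total functions vanishing off SigmaA *)
definition ext_funs :: "nat \<Rightarrow> (nat \<Rightarrow> nat \<Rightarrow> nat) \<Rightarrow> ((nat \<Rightarrow> nat) \<Rightarrow> complex) set" where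
  "ext_funs N A = {\<phi>. \<forall>w. w \<notin> SigmaA N A \<longrightarrow> \<phi> w = 0}"

(* var_m(phi), as an extended real (a priori possibly infinite) *)
definition var :: "nat \<Rightarrow> (nat \<Rightarrow> nat \<Rightarrow> nat) \<Rightarrow> nat \<Rightarrow> ((nat \<Rightarrow> nat) \<Rightarrow> complex) \<Rightarrow> ereal" where
  "var N A m \<phi> = (SUP p \<in> {(w, w'). w \<in> SigmaA N A \<and> w' \<in> SigmaA N A \<and> (\<forall>k<m. w k = w' k)}.
                     ereal (cmod (\<phi> (fst p) - \<phi> (snd p))))"

definition Vsp :: "nat \<Rightarrow> (nat \<Rightarrow> nat \<Rightarrow> nat) \<Rightarrow> ((nat \<Rightarrow> nat) \<Rightarrow> complex) set" where
  "Vsp N A = {\<phi> \<in> ext_funs N A. (\<forall>m. var N A m \<phi> \<noteq> \<infinity>) \<and>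
       (\<lambda>m. root m (real_of_ereal (var N A m \<phi>))) \<longlonglongrightarrow> 0}"

definition transfer :: "nat \<Rightarrow> (nat \<Rightarrow> nat \<Rightarrow> nat) \<Rightarrow> ((nat \<Rightarrow> nat) \<Rightarrow> complex)
     \<Rightarrow> ((nat \<Rightarrow> nat) \<Rightarrow> complex) \<Rightarrow> ((nat \<Rightarrow> nat) \<Rightarrow> complex)" where
  "transfer N A f \<phi> = (\<lambda>w. \<Sum>w'\<in>{w'. w' \<in> SigmaA N A \<and> shift w' = w}. exp (f w') * \<phi> w')"

definition Lambda_f :: "nat \<Rightarrow> (nat \<Rightarrow> nat \<Rightarrow> nat) \<Rightarrow> ((nat \<Rightarrow> nat) \<Rightarrow> complex) \<Rightarrow> complex set" where
  "Lambda_f N A f = {l. l \<noteq> 0 \<and> (\<exists>\<phi>\<in>Vsp N A. \<phi> \<noteq> (\<lambda>w. 0) \<and> transfer N A f \<phi> = (\<lambda>w. l * \<phi> w))}"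

(* the space B({theta_m}); theta is indexed from 1, theta 0 is unused *)
definition Bsp :: "nat \<Rightarrow> (nat \<Rightarrow> nat \<Rightarrow> nat) \<Rightarrow> (nat \<Rightarrow> real) \<Rightarrow> ((nat \<Rightarrow> nat) \<Rightarrow> complex) set" where
  "Bsp N A \<theta> = {\<phi> \<in> Vsp N A. \<exists>C\<ge>0. \<forall>m. var N A m \<phi> \<le> ereal (C * \<theta> (Suc m) ^ m)}"

definition supnorm :: "nat \<Rightarrow> (nat \<Rightarrow> nat \<Rightarrow> nat) \<Rightarrow> ((nat \<Rightarrow> nat) \<Rightarrow> complex) \<Rightarrow> real" where
  "supnorm N A \<phi> = Sup ((\<lambda>w. cmod (\<phi> w)) ` SigmaA N A)"

definition Bnorm :: "nat \<Rightarrow> (nat \<Rightarrow> nat \<Rightarrow> nat) \<Rightarrow> (nat \<Rightarrow> real) \<Rightarrow> ((nat \<Rightarrow> nat) \<Rightarrow> complex) \<Rightarrow> real" where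
  "Bnorm N A \<theta> \<phi> = supnorm N A \<phi> + Inf {C. C \<ge> 0 \<and> (\<forall>m. var N A m \<phi> \<le> ereal (C * \<theta> (Suc m) ^ m))}"

definition compact_on_B :: "nat \<Rightarrow> (nat \<Rightarrow> nat \<Rightarrow> nat) \<Rightarrow> (nat \<Rightarrow> real)
     \<Rightarrow> (((nat \<Rightarrow> nat) \<Rightarrow> complex) \<Rightarrow> ((nat \<Rightarrow> nat) \<Rightarrow> complex)) \<Rightarrow> bool" where
  "compact_on_B N A \<theta> T \<longleftrightarrow>
     (\<forall>\<phi>\<in>Bsp N A \<theta>. T \<phi> \<in> Bsp N A \<theta>) \<and>
     (\<forall>\<phi>\<in>Bsp N A \<theta>. \<forall>\<psi>\<in>Bsp N A \<theta>. \<forall>(a::complex) (b::complex). T (\<lambda>w. a * \<phi> w + b * \<psi> w) = (\<lambda>w. a * T \<phi> w + b * T \<psi> w)) \<and>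
     (\<forall>s. (\<forall>n. s n \<in> Bsp N A \<theta>) \<longrightarrow> (\<exists>M::real. \<forall>n. Bnorm N A \<theta> (s n) \<le> M) \<longrightarrow>
        (\<exists>(r::nat\<Rightarrow>nat) \<psi>. strict_mono r \<and> \<psi> \<in> Bsp N A \<theta> \<and>
            (\<lambda>n. Bnorm N A \<theta> (\<lambda>w. T (s (r n)) w - \<psi> w)) \<longlonglongrightarrow> 0))"

definition spectrum_on_B :: "nat \<Rightarrow> (nat \<Rightarrow> nat \<Rightarrow> nat) \<Rightarrow> (nat \<Rightarrow> real)
     \<Rightarrow> (((nat \<Rightarrow> nat) \<Rightarrow> complex) \<Rightarrow> ((nat \<Rightarrow> nat) \<Rightarrow> complex)) \<Rightarrow> complex set" where
  "spectrum_on_B N A \<theta> T = {l. \<not> (\<exists>R. (\<forall>\<phi>\<in>Bsp N A \<theta>. R \<phi> \<in> Bsp N A \<theta>) \<and>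
        (\<forall>\<phi>\<in>Bsp N A \<theta>. \<forall>\<psi>\<in>Bsp N A \<theta>. \<forall>(a::complex) (b::complex). R (\<lambda>w. a * \<phi> w + b * \<psi> w) = (\<lambda>w. a * R \<phi> w + b * R \<psi> w)) \<and>
        (\<exists>C::real. \<forall>\<phi>\<in>Bsp N A \<theta>. Bnorm N A \<theta> (R \<phi>) \<le> C * Bnorm N A \<theta> \<phi>) \<and>
        (\<forall>\<phi>\<in>Bsp N A \<theta>. R (\<lambda>w. T \<phi> w - l * \<phi> w) = \<phi>) \<and>
        (\<forall>\<phi>\<in>Bsp N A \<theta>. (\<lambda>w. T (R \<phi>) w - l * R \<phi> w) = \<phi>))}"

definition cindep :: "((nat \<Rightarrow> nat) \<Rightarrow> complex) set \<Rightarrow> bool" where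
  "cindep S \<longleftrightarrow> (\<forall>c. (\<lambda>w. \<Sum>t\<in>S. c t * t w) = (\<lambda>w. 0) \<longrightarrow> (\<forall>t\<in>S. c t = 0))"

definition cdim :: "((nat \<Rightarrow> nat) \<Rightarrow> complex) set \<Rightarrow> enat" where
  "cdim S = Sup {enat (card T) | T. finite T \<and> T \<subseteq> S \<and> cindep T}"

definition gen_eigenspace :: "((nat \<Rightarrow> nat) \<Rightarrow> complex) set
     \<Rightarrow> (((nat \<Rightarrow> nat) \<Rightarrow> complex) \<Rightarrow> ((nat \<Rightarrow> nat) \<Rightarrow> complex)) \<Rightarrow> complex
     \<Rightarrow> ((nat \<Rightarrow> nat) \<Rightarrow> complex) set" where
  "gen_eigenspace E T l = {\<phi>\<in>E. \<exists>k. ((\<lambda>\<psi>. \<lambda>w. T \<psi> w - l * \<psi> w) ^^ k) \<phi> = (\<lambda>w. 0)}"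

definition eig_mult :: "((nat \<Rightarrow> nat) \<Rightarrow> complex) set
     \<Rightarrow> (((nat \<Rightarrow> nat) \<Rightarrow> complex) \<Rightarrow> ((nat \<Rightarrow> nat) \<Rightarrow> complex)) \<Rightarrow> complex \<Rightarrow> enat" where
  "eig_mult E T l = cdim (gen_eigenspace E T l)"

end

theory Submission
  imports Defs "HOL-Complex_Analysis.Great_Picard" "HOL-Library.Function_Algebras"
begin

text \<open>Every preimage of \<open>w\<close> under the shift prepends one symbol, so the \<open>m\<close>-th variation of the transferred
  function is controlled by the \<open>(m+1)\<close>-st variations of \<open>f\<close> and \<open>\<phi>\<close>. On \<open>Bsp\<close> these are bounded by
  \<open>\<theta>\<^sub>m\<^sub>+\<^sub>1 ^ (m+1)\<close>, one factor \<open>\<theta>\<^sub>m\<^sub>+\<^sub>1 \<rightarrow> 0\<close> better than membership in \<open>Bsp\<close> requires; together with an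
  Arzela-Ascoli argument this gives compactness. Iterating the same estimate in
  \<open>l * \<psi> = L \<psi> - \<chi>\<close> shows that a super-continuous \<open>\<psi>\<close> with \<open>\<chi> \<in> Bsp\<close> already lies in \<open>Bsp\<close>. Hence the
  generalized eigenspaces in \<open>Vsp\<close> and \<open>Bsp\<close> coincide as sets, and the Riesz theory of compact operators
  identifies the nonzero spectrum on \<open>Bsp\<close> with the nonzero eigenvalues.\<close>

section \<open>The Fredholm alternative for compact operators\<close>

text \<open>\<open>Bsp\<close> depends on the sequence \<open>\<theta>\<close> and is a set of total
  functions, not a type, so the operator theory is developed for a carrier set \<open>E\<close> with
  an explicit scaling and norm function. The part of Riesz theory used is "injective implies
  boundedly invertible", and every limit it takes is supplied by compactness of the operator. Two
  degenerate situations shape the estimates. First, \<open>\<theta> m\<close> may be 0, so a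
  variation bound cannot always be divided by its weight; such levels are split off, since a zero
  weight forces a zero variation. Second, points that agree in no coordinate may have different sets
  of admissible preceding symbols, so at level 0 the preimages cannot be matched; there only the sup
  norm is available and nothing is gained. The regularity step rests on monotonicity of
  \<open>\<theta>\<close>: it yields \<open>\<theta> (Suc (m + J)) ^ (m + J) \<le> \<theta> (Suc m)
  ^ m * \<theta> (Suc J) ^ J\<close>, which separates the wanted weight from a convergent series
  that does not depend on \<open>m\<close>. Multiplicities then agree without any dimension count,
  because \<open>eig_mult\<close> is the dimension of one and the same set.\<close>

locale normed_subspace = vector_space scale
  for scale :: "complex \<Rightarrow> 'b::ab_group_add \<Rightarrow> 'b" (infixr \<open>\<odot>\<close> 75) +
  fixes E :: "'b set" and nrm :: "'b \<Rightarrow> real"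
  assumes subspace_carrier: "subspace E"
    and nrm_triangle: "x \<in> E \<Longrightarrow> y \<in> E \<Longrightarrow> nrm (x + y) \<le> nrm x + nrm y"
    and nrm_scale: "x \<in> E \<Longrightarrow> nrm (c \<odot> x) = cmod c * nrm x"
    and nrm_definite: "x \<in> E \<Longrightarrow> nrm x = 0 \<Longrightarrow> x = 0"
begin

lemma carrier_simps [simp]:
  "0 \<in> E"
  "x \<in> E \<Longrightarrow> y \<in> E \<Longrightarrow> x + y \<in> E"
  "x \<in> E \<Longrightarrow> y \<in> E \<Longrightarrow> x - y \<in> E"
  "x \<in> E \<Longrightarrow> c \<odot> x \<in> E"
  "x \<in> E \<Longrightarrow> - x \<in> E"
  using subspace_carrier
  by (auto intro: subspace_0 subspace_add subspace_diff subspace_scale subspace_neg)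

lemma nrm_0 [simp]: "nrm 0 = 0"
  using nrm_scale[of 0 0] by simp

lemma nrm_minus: "x \<in> E \<Longrightarrow> nrm (- x) = nrm x"
  using nrm_scale[of x "- 1"] by simp

lemma nrm_minus_commute: "x \<in> E \<Longrightarrow> y \<in> E \<Longrightarrow> nrm (x - y) = nrm (y - x)"
  using nrm_minus[of "x - y"] by simp

lemma nrm_triangle_diff: "x \<in> E \<Longrightarrow> y \<in> E \<Longrightarrow> nrm (x - y) \<le> nrm x + nrm y"
  using nrm_triangle[of x "- y"] nrm_minus[of y] by simp

lemma nrm_triangle_sub: "x \<in> E \<Longrightarrow> y \<in> E \<Longrightarrow> nrm x \<le> nrm y + nrm (x - y)"
  using nrm_triangle[of y "x - y"] by simp

lemma nrm_nonneg: "x \<in> E \<Longrightarrow> 0 \<le> nrm x"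
  using nrm_triangle[of x "- x"] nrm_minus[of x] by simp

lemma nrm_pos: "x \<in> E \<Longrightarrow> x \<noteq> 0 \<Longrightarrow> 0 < nrm x"
  using nrm_nonneg nrm_definite by force

lemma nrm_normalize: "x \<in> E \<Longrightarrow> x \<noteq> 0 \<Longrightarrow> nrm (complex_of_real (inverse (nrm x)) \<odot> x) = 1"
  using nrm_pos[of x] by (simp add: nrm_scale norm_inverse)

text \<open>Closedness relative to \<open>E\<close>, phrased by sequences because \<open>E\<close>
  carries only a norm function and no topology.\<close>

definition seq_closed :: "'b set \<Rightarrow> bool" where
  "seq_closed M \<longleftrightarrow>
     (\<forall>s y. (\<forall>n::nat. s n \<in> M) \<longrightarrow> y \<in> E \<longrightarrow> (\<lambda>n. nrm (s n - y)) \<longlonglongrightarrow> 0 \<longrightarrow> y \<in> M)"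

lemma seq_closedD:
  "seq_closed M \<Longrightarrow> (\<And>n::nat. s n \<in> M) \<Longrightarrow> y \<in> E \<Longrightarrow> (\<lambda>n. nrm (s n - y)) \<longlonglongrightarrow> 0 \<Longrightarrow> y \<in> M"
  unfolding seq_closed_def by metis

text \<open>Closedness makes the distance \<open>d\<close> from \<open>u\<close> to \<open>M\<close>
  positive. Normalizing \<open>u - y0\<close> for a point \<open>y0\<close> of \<open>M\<close> that
  is nearer than \<open>2 * d\<close> to \<open>u\<close> gives the constant 1/2. The larger space
  \<open>M'\<close> is kept general because the lemma is applied between consecutive iterated
  images.\<close>

lemma Riesz_lemma:
  assumes M: "subspace M" "M \<subseteq> E" "seq_closed M"
    and M': "subspace M'" "M' \<subseteq> E" "M \<subseteq> M'"
    and u: "u \<in> M'" "u \<notin> M"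
  shows "\<exists>x\<in>M'. nrm x = 1 \<and> (\<forall>y\<in>M. 1/2 \<le> nrm (x - y))"
proof -
  define D where "D = (\<lambda>y. nrm (u - y)) ` M"
  have uE: "u \<in> E" using u M' by auto
  have D_ne: "D \<noteq> {}" using M(1) subspace_0 by (auto simp: D_def)
  have D_nonneg: "0 \<le> t" if "t \<in> D" for t
    using that uE M(2) by (auto simp: D_def intro!: nrm_nonneg)
  have D_bdd: "bdd_below D" using D_nonneg by (auto simp: bdd_below_def)
  define d where "d = Inf D"
  have d_le: "d \<le> nrm (u - y)" if "y \<in> M" for y
    using that D_bdd by (auto simp: d_def D_def intro: cInf_lower)
  have "d \<noteq> 0"
  proof
    assume "d = 0"
    have "\<exists>y\<in>M. nrm (u - y) < inverse (real (Suc n))" for n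
    proof -
      have "Inf D < inverse (real (Suc n))" using \<open>d = 0\<close> by (simp add: d_def)
      then show ?thesis using cInf_lessD[OF D_ne] by (auto simp: D_def)
    qed
    then obtain y where y: "\<And>n. y n \<in> M" "\<And>n. nrm (u - y n) < inverse (real (Suc n))" by metis
    have "(\<lambda>n. nrm (y n - u)) \<longlonglongrightarrow> 0"
    proof (rule Lim_null_comparison[OF _ LIMSEQ_inverse_real_of_nat])
      show "\<forall>\<^sub>F n in sequentially. norm (nrm (y n - u)) \<le> inverse (real (Suc n))"
      proof (intro always_eventually allI)
        fix n
        have "nrm (y n - u) = nrm (u - y n)" "0 \<le> nrm (u - y n)"
          using nrm_minus_commute uE y(1)[of n] M(2) by (auto intro!: nrm_nonneg)
        then show "norm (nrm (y n - u)) \<le> inverse (real (Suc n))" using y(2)[of n] by simp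
      qed
    qed
    then have "u \<in> M" by (rule seq_closedD[OF M(3) y(1) uE])
    then show False using u by simp
  qed
  moreover have "0 \<le> d" unfolding d_def using D_ne D_nonneg by (rule cInf_greatest)
  ultimately have d: "0 < d" by simp
  then have "Inf D < 2 * d" by (simp add: d_def)
  then obtain y0 where y0: "y0 \<in> M" "nrm (u - y0) < 2 * d"
    using cInf_lessD[OF D_ne] by (auto simp: D_def)
  define v where "v = u - y0"
  define c where "c = complex_of_real (inverse (nrm v))"
  have vE: "v \<in> E" using uE y0 M(2) by (auto simp: v_def)
  have v_pos: "0 < nrm v" using d d_le[OF y0(1)] by (simp add: v_def)
  have v0: "v \<noteq> 0" using v_pos by auto
  have c0: "c \<noteq> 0" using v_pos by (simp add: c_def)
  have "c \<odot> v \<in> M'" using u y0 M' by (auto simp: v_def intro: subspace_scale subspace_diff)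
  moreover have "nrm (c \<odot> v) = 1" using nrm_normalize[OF vE v0] by (simp add: c_def)
  moreover have "1/2 \<le> nrm (c \<odot> v - y)" if y: "y \<in> M" for y
  proof -
    \<comment> \<open>Chosen so that \<open>c \<odot> v - y = c \<odot> (u - z)\<close> with
      \<open>z\<close> in \<open>M\<close>; the distance bound \<open>d\<close> then applies to
      \<open>z\<close>.\<close>
    define z where "z = y0 + inverse c \<odot> y"
    have z: "z \<in> M" using y y0 M(1) by (auto simp: z_def intro: subspace_add subspace_scale)
    have "c \<odot> v - y = c \<odot> (u - z)"
      using c0 by (simp add: v_def z_def scale_right_diff_distrib scale_right_distrib)
    then have "nrm (c \<odot> v - y) = nrm (u - z) / nrm v"
      using uE z M(2) v_pos by (auto simp: nrm_scale c_def norm_inverse divide_inverse mult.commute)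
    also have "\<dots> \<ge> d / (2 * d)"
      using d_le[OF z] y0(2) v_pos d by (intro frac_le) (auto simp: v_def)
    finally show ?thesis using d by simp
  qed
  ultimately show ?thesis by blast
qed

end

locale compact_operator = normed_subspace scale E nrm
  for scale :: "complex \<Rightarrow> 'b::ab_group_add \<Rightarrow> 'b" (infixr \<open>\<odot>\<close> 75)
    and E :: "'b set" and nrm :: "'b \<Rightarrow> real" +
  fixes T :: "'b \<Rightarrow> 'b"
  assumes T_carrier [simp]: "x \<in> E \<Longrightarrow> T x \<in> E"
    and T_add: "x \<in> E \<Longrightarrow> y \<in> E \<Longrightarrow> T (x + y) = T x + T y"
    and T_scale: "x \<in> E \<Longrightarrow> T (c \<odot> x) = c \<odot> T x"
    and T_compact: "(\<And>n::nat. s n \<in> E) \<Longrightarrow> (\<And>n. nrm (s n) \<le> B) \<Longrightarrow>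
      \<exists>r y. strict_mono (r::nat \<Rightarrow> nat) \<and> y \<in> E \<and> (\<lambda>n. nrm (T (s (r n)) - y)) \<longlonglongrightarrow> 0"
begin

lemma T_0: "T 0 = 0"
  using T_scale[of 0 0] by simp

text \<open>Otherwise some unit vectors have images of norm above \<open>Suc n\<close> for every
  \<open>n\<close>; no subsequence of these images is bounded, let alone convergent.\<close>

lemma T_bounded: "\<exists>C>0. \<forall>x\<in>E. nrm (T x) \<le> C * nrm x"
proof (rule ccontr)
  assume neg: "\<not> ?thesis"
  have "\<exists>x\<in>E. nrm x = 1 \<and> real (Suc n) < nrm (T x)" for n
  proof -
    have "\<not> (\<forall>x\<in>E. nrm (T x) \<le> real (Suc n) * nrm x)" using neg of_nat_0_less_iff[of "Suc n"] by blast
    then obtain x where x: "x \<in> E" "real (Suc n) * nrm x < nrm (T x)" by (auto simp: not_le)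
    have x0: "x \<noteq> 0" using x by (auto simp: T_0)
    define y where "y = complex_of_real (inverse (nrm x)) \<odot> x"
    have "y \<in> E" "nrm y = 1" using x nrm_normalize[OF x(1) x0] by (auto simp: y_def)
    moreover have "nrm (T y) = nrm (T x) / nrm x"
      using x nrm_pos[OF x(1) x0]
      by (simp add: y_def T_scale nrm_scale norm_inverse divide_inverse mult.commute)
    then have "real (Suc n) < nrm (T y)"
      using x nrm_pos[OF x(1) x0] by (simp add: pos_less_divide_eq)
    ultimately show ?thesis by blast
  qed
  then obtain x where x: "\<And>n. x n \<in> E" "\<And>n. nrm (x n) = 1" "\<And>n. real (Suc n) < nrm (T (x n))"
    by metis
  obtain r y where r: "strict_mono (r::nat \<Rightarrow> nat)" "y \<in> E" "(\<lambda>n. nrm (T (x (r n)) - y)) \<longlonglongrightarrow> 0"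
    using T_compact[of x 1] x by auto
  obtain n where n: "\<And>k. k \<ge> n \<Longrightarrow> nrm (T (x (r k)) - y) < 1"
    using order_tendstoD(2)[OF r(3), of 1] by (auto simp: eventually_sequentially)
  obtain j where j: "nrm y \<le> real j" using real_arch_simple by blast
  define k where "k = max n j"
  have k: "k \<ge> n" "real k \<ge> nrm y" using j by (auto simp: k_def)
  have "nrm (T (x (r k))) \<le> nrm y + nrm (T (x (r k)) - y)"
    using nrm_triangle_sub x r by simp
  also have "\<dots> < real (Suc k)" using n[OF k(1)] k(2) by simp
  also have "\<dots> \<le> real (Suc (r k))" using seq_suble[OF r(1), of k] by simp
  finally show False using x(3)[of "r k"] by simp
qed

context
  fixes l :: complex
  assumes l: "l \<noteq> 0"
begin

definition S :: "'b \<Rightarrow> 'b" where "S x = T x - l \<odot> x"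

lemma S_carrier [simp]: "x \<in> E \<Longrightarrow> S x \<in> E"
  by (simp add: S_def)

lemma S_add: "x \<in> E \<Longrightarrow> y \<in> E \<Longrightarrow> S (x + y) = S x + S y"
  by (simp add: S_def T_add scale_right_distrib)

lemma S_scale: "x \<in> E \<Longrightarrow> S (c \<odot> x) = c \<odot> S x"
  by (simp add: S_def T_scale scale_right_diff_distrib mult.commute)

lemma S_diff: "x \<in> E \<Longrightarrow> y \<in> E \<Longrightarrow> S (x - y) = S x - S y"
  using S_add[of "x - y" y] by simp

lemma S_0: "S 0 = 0"
  by (simp add: S_def T_0)

lemma S_bounded: "\<exists>C>0. \<forall>x\<in>E. nrm (S x) \<le> C * nrm x"
proof -
  obtain C where C: "C > 0" "\<And>x. x \<in> E \<Longrightarrow> nrm (T x) \<le> C * nrm x" using T_bounded by auto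
  have "nrm (S x) \<le> (C + cmod l) * nrm x" if "x \<in> E" for x
    using nrm_triangle_diff[of "T x" "l \<odot> x"] C(2)[OF that] that
    by (simp add: S_def nrm_scale algebra_simps)
  then show ?thesis using C(1) by (intro exI[of _ "C + cmod l"]) (auto intro: add_pos_nonneg)
qed

text \<open>Compactness of \<open>T\<close> replaces completeness of \<open>E\<close>: a bounded sequence with convergent
  \<open>S\<close>-images has a convergent subsequence because \<open>l \<odot> x = T x - S x\<close>.\<close>
lemma S_proper:
  assumes x: "\<And>n::nat. x n \<in> E" "\<And>n. nrm (x n) \<le> B" and y: "y \<in> E" "(\<lambda>n. nrm (S (x n) - y)) \<longlonglongrightarrow> 0"
  shows "\<exists>r z. strict_mono (r::nat \<Rightarrow> nat) \<and> z \<in> E \<and> (\<lambda>n. nrm (x (r n) - z)) \<longlonglongrightarrow> 0 \<and> S z = y"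
proof -
  obtain r t where r: "strict_mono (r::nat \<Rightarrow> nat)" and t: "t \<in> E" "(\<lambda>n. nrm (T (x (r n)) - t)) \<longlonglongrightarrow> 0"
    using T_compact[of x B] x by auto
  have Sr: "(\<lambda>n. nrm (S (x (r n)) - y)) \<longlonglongrightarrow> 0"
    using LIMSEQ_subseq_LIMSEQ[OF y(2) r] by (simp add: o_def)
  define z where "z = inverse l \<odot> (t - y)"
  have z: "z \<in> E" using t y by (simp add: z_def)
  have bound: "nrm (x (r n) - z) \<le> (nrm (T (x (r n)) - t) + nrm (S (x (r n)) - y)) / cmod l" for n
  proof -
    have "x (r n) - z = inverse l \<odot> ((T (x (r n)) - t) - (S (x (r n)) - y))"
      using l by (simp add: S_def z_def scale_right_diff_distrib)
    then have "nrm (x (r n) - z) = nrm ((T (x (r n)) - t) - (S (x (r n)) - y)) / cmod l"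
      using x t y by (simp add: nrm_scale norm_inverse divide_inverse mult.commute)
    also have "\<dots> \<le> (nrm (T (x (r n)) - t) + nrm (S (x (r n)) - y)) / cmod l"
      using x t y by (intro divide_right_mono nrm_triangle_diff) auto
    finally show ?thesis .
  qed
  have lim: "(\<lambda>n. nrm (x (r n) - z)) \<longlonglongrightarrow> 0"
  proof (rule Lim_null_comparison)
    show "(\<lambda>n. (nrm (T (x (r n)) - t) + nrm (S (x (r n)) - y)) / cmod l) \<longlonglongrightarrow> 0"
      using tendsto_divide[OF tendsto_add[OF t(2) Sr] tendsto_const[of "cmod l"]] l by simp
    show "\<forall>\<^sub>F n in sequentially. norm (nrm (x (r n) - z)) \<le>
            (nrm (T (x (r n)) - t) + nrm (S (x (r n)) - y)) / cmod l"
      using bound nrm_nonneg x z by (intro always_eventually allI) simp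
  qed
  obtain C where C: "C > 0" "\<And>x. x \<in> E \<Longrightarrow> nrm (S x) \<le> C * nrm x" using S_bounded by auto
  have bound_S: "nrm (S z - y) \<le> C * nrm (x (r n) - z) + nrm (S (x (r n)) - y)" for n
  proof -
    have "(S (x (r n)) - y) - S (x (r n) - z) = S z - y" using x z by (simp add: S_diff)
    then have "nrm (S z - y) \<le> nrm (S (x (r n)) - y) + nrm (S (x (r n) - z))"
      using nrm_triangle_diff[of "S (x (r n)) - y" "S (x (r n) - z)"] x(1) y(1) z by (metis S_carrier carrier_simps(3))
    then show ?thesis using C(2)[of "x (r n) - z"] x z by simp
  qed
  have "(\<lambda>n. C * nrm (x (r n) - z) + nrm (S (x (r n)) - y)) \<longlonglongrightarrow> 0"
    using tendsto_add[OF tendsto_mult[OF tendsto_const[of C] lim] Sr] by simp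
  then have "nrm (S z - y) \<le> 0" using bound_S by (intro LIMSEQ_le_const[of _ 0]) blast+
  then have "S z - y = 0" using nrm_nonneg[of "S z - y"] y z by (intro nrm_definite) auto
  then show ?thesis using r z lim by auto
qed

section \<open>The injective case: lower bound, closed images, surjectivity\<close>

context
  assumes inj: "\<And>x. x \<in> E \<Longrightarrow> S x = 0 \<Longrightarrow> x = 0"
begin

text \<open>A violation yields unit vectors with \<open>S\<close>-images tending to 0; by
  \<open>S_proper\<close> a subsequence converges to a kernel element, which is 0, against norm one.
  The constant later bounds the inverse, in the role of the bounded inverse theorem.\<close>

lemma S_bounded_below: "\<exists>c>0. \<forall>x\<in>E. c * nrm x \<le> nrm (S x)"
proof (rule ccontr)
  assume neg: "\<not> ?thesis"
  have "\<exists>x\<in>E. nrm x = 1 \<and> nrm (S x) < inverse (real (Suc n))" for n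
  proof -
    have "0 < inverse (real (Suc n))" by simp
    then have "\<not> (\<forall>x\<in>E. inverse (real (Suc n)) * nrm x \<le> nrm (S x))" using neg by blast
    then obtain x where x: "x \<in> E" "nrm (S x) < inverse (real (Suc n)) * nrm x"
      by (auto simp: not_le)
    have x0: "x \<noteq> 0" using x by (auto simp: S_0)
    define y where "y = complex_of_real (inverse (nrm x)) \<odot> x"
    have "y \<in> E" "nrm y = 1" using x nrm_normalize[OF x(1) x0] by (auto simp: y_def)
    moreover have "nrm (S y) = nrm (S x) / nrm x"
      using x nrm_pos[OF x(1) x0]
      by (simp add: y_def S_scale nrm_scale norm_inverse divide_inverse mult.commute)
    then have "nrm (S y) < inverse (real (Suc n))"
      using x nrm_pos[OF x(1) x0] by (simp add: pos_divide_less_eq)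
    ultimately show ?thesis by blast
  qed
  then obtain x where x: "\<And>n. x n \<in> E" "\<And>n. nrm (x n) = 1" "\<And>n. nrm (S (x n)) < inverse (real (Suc n))"
    by metis
  have "(\<lambda>n. nrm (S (x n) - 0)) \<longlonglongrightarrow> 0"
  proof (rule Lim_null_comparison[OF _ LIMSEQ_inverse_real_of_nat])
    show "\<forall>\<^sub>F n in sequentially. norm (nrm (S (x n) - 0)) \<le> inverse (real (Suc n))"
      using x nrm_nonneg by (intro always_eventually allI) (simp add: less_imp_le)
  qed
  then obtain r z where r: "z \<in> E" "(\<lambda>n. nrm (x (r n) - z)) \<longlonglongrightarrow> 0" "S z = 0"
    using S_proper[of x 1 0] x by auto
  then have "z = 0" using inj by blast
  then show False using r(2) x(2) by (simp add: LIMSEQ_const_iff)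
qed

text \<open>Preimages of a convergent sequence stay bounded by \<open>S_bounded_below\<close>, so
  \<open>S_proper\<close> extracts a limit of preimages, which remains in \<open>M\<close>. This
  makes \<open>Riesz_lemma\<close> applicable to all iterated images of \<open>E\<close>.\<close>

lemma S_image_closed:
  assumes "M \<subseteq> E" "seq_closed M"
  shows "seq_closed (S ` M)"
  unfolding seq_closed_def
proof (intro allI impI)
  fix s y assume s: "\<forall>n::nat. s n \<in> S ` M" and y: "y \<in> E" "(\<lambda>n. nrm (s n - y)) \<longlonglongrightarrow> 0"
  obtain x where x: "\<And>n. x n \<in> M" "\<And>n. s n = S (x n)"
  proof -
    have "\<forall>n. \<exists>u. u \<in> M \<and> s n = S u" using s by blast
    then show ?thesis using that by metis
  qed
  have xE: "x n \<in> E" for n using x assms by auto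
  obtain c where c: "c > 0" "\<And>x. x \<in> E \<Longrightarrow> c * nrm x \<le> nrm (S x)" using S_bounded_below by auto
  obtain B where B: "\<And>n. norm (nrm (s n - y)) \<le> B"
    using convergent_imp_Bseq[OF convergentI[OF y(2)]] by (auto simp: Bseq_def)
  have x_bdd: "nrm (x n) \<le> (nrm y + B) / c" for n
  proof -
    have "c * nrm (x n) \<le> nrm (s n)" using c(2)[OF xE] x by simp
    also have "\<dots> \<le> nrm y + nrm (s n - y)" using nrm_triangle_sub[of "s n" y] xE y x by simp
    also have "\<dots> \<le> nrm y + B" using B[of n] by simp
    finally show ?thesis using c(1) by (simp add: pos_le_divide_eq mult.commute)
  qed
  have "(\<lambda>n. nrm (S (x n) - y)) \<longlonglongrightarrow> 0" using y(2) x(2) by simp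
  from S_proper[OF xE x_bdd y(1) this]
  obtain r z where r: "z \<in> E" "(\<lambda>n. nrm (x (r n) - z)) \<longlonglongrightarrow> 0" "S z = y" by blast
  have "z \<in> M" using x(1) by (rule seq_closedD[OF assms(2) _ r(1,2)])
  then show "y \<in> S ` M" using r(3) by blast
qed

lemma S_image_subspace:
  assumes "M \<subseteq> E" "subspace M"
  shows "subspace (S ` M)"
proof (rule subspaceI)
  show "0 \<in> S ` M" using S_0 subspace_0[OF assms(2)] by force
next
  fix x y assume "x \<in> S ` M" "y \<in> S ` M"
  then obtain u v where uv: "u \<in> M" "v \<in> M" "x = S u" "y = S v" by auto
  then have "x + y = S (u + v)" by (simp add: S_add subsetD[OF assms(1)])
  then show "x + y \<in> S ` M" using uv subspace_add[OF assms(2)] by blast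
next
  fix c x assume "x \<in> S ` M"
  then obtain u where u: "u \<in> M" "x = S u" by auto
  then have "c \<odot> x = S (c \<odot> u)" by (simp add: S_scale subsetD[OF assms(1)])
  then show "c \<odot> x \<in> S ` M" using u subspace_scale[OF assms(2)] by blast
qed

text \<open>If \<open>u\<close> is not attained, the images \<open>R n\<close> of the powers of
  \<open>S\<close> form a strictly decreasing chain of closed subspaces. Riesz unit vectors chosen
  along this chain have \<open>T\<close>-images that are uniformly separated, which compactness
  forbids.\<close>

lemma S_surj: "S ` E = E"
proof (rule ccontr)
  assume "S ` E \<noteq> E"
  then obtain u where u: "u \<in> E" "u \<notin> S ` E" using S_carrier by blast
  define R where "R n = (S ^^ n) ` E" for n
  have R_0: "R 0 = E" and R_Suc: "R (Suc n) = S ` R n" for n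
    by (auto simp: R_def image_image)
  have R_sub: "R n \<subseteq> E" for n by (induction n) (auto simp: R_0 R_Suc)
  have R_subspace: "subspace (R n)" for n
    by (induction n) (use R_sub in \<open>auto simp: R_0 R_Suc subspace_carrier intro!: S_image_subspace\<close>)
  have R_closed: "seq_closed (R n)" for n
  proof (induction n)
    case 0
    show ?case by (simp add: R_0 seq_closed_def)
  next
    case (Suc n)
    then show ?case using R_sub by (auto simp: R_Suc intro!: S_image_closed)
  qed
  have R_step: "R (Suc n) \<subseteq> R n" for n
    by (induction n) (auto simp: R_0 R_Suc)
  have R_mono: "R n \<subseteq> R m" if "m \<le> n" for m n
    using lift_Suc_antimono_le[of R m n] R_step that by blast
  \<comment> \<open>Injectivity transports strictness of the first inclusion to every level.\<close>
  have Su: "(S ^^ n) u \<in> R n - R (Suc n)" for n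
  proof (induction n)
    case 0
    show ?case using u by (simp add: R_0 R_Suc)
  next
    case (Suc n)
    have "S ((S ^^ n) u) \<notin> S ` R (Suc n)"
    proof
      assume "S ((S ^^ n) u) \<in> S ` R (Suc n)"
      then obtain v where v: "v \<in> R (Suc n)" "S ((S ^^ n) u) = S v" by auto
      have E: "v \<in> E" "(S ^^ n) u \<in> E" using v Suc R_sub by auto
      have "S ((S ^^ n) u - v) = 0" using S_diff[OF E(2,1)] v by simp
      then have "(S ^^ n) u = v" using inj[of "(S ^^ n) u - v"] E by simp
      then show False using Suc v by simp
    qed
    then show ?case using Suc by (auto simp: R_Suc)
  qed
  have "\<exists>x\<in>R n. nrm x = 1 \<and> (\<forall>y\<in>R (Suc n). 1/2 \<le> nrm (x - y))" for n
    using Riesz_lemma[OF R_subspace R_sub R_closed R_subspace R_sub R_step] Su by blast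
  then obtain x where x: "\<And>n. x n \<in> R n" "\<And>n. nrm (x n) = 1"
    "\<And>n y. y \<in> R (Suc n) \<Longrightarrow> 1/2 \<le> nrm (x n - y)" by metis
  have xE: "x n \<in> E" for n using x R_sub by blast
  have sep: "cmod l / 2 \<le> nrm (T (x a) - T (x b))" if "a < b" for a b
  proof -
    \<comment> \<open>Obtained by substituting \<open>T x = S x + l \<odot> x\<close> in
      \<open>T (x a) - T (x b)\<close> and factoring out \<open>l\<close>; all terms other than
      \<open>x a\<close> land in \<open>R (Suc a)\<close>.\<close>
    define y where "y = inverse l \<odot> (S (x b) - S (x a)) + x b"
    have "x b \<in> R (Suc a)" "S (x b) \<in> R (Suc a)" "S (x a) \<in> R (Suc a)"
      using x(1)[of b] R_mono[of "Suc a" b] R_mono[of "Suc a" "Suc b"] that x(1)[of a]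
      by (auto simp: R_Suc[of b] R_Suc[of a])
    then have "y \<in> R (Suc a)"
      unfolding y_def by (intro subspace_add subspace_scale subspace_diff R_subspace) auto
    moreover have "T (x a) - T (x b) = l \<odot> (x a - y)"
      using l by (simp add: y_def S_def scale_right_diff_distrib scale_right_distrib)
    ultimately show ?thesis using x(3)[of y a] R_sub[of "Suc a"] xE l
      by (auto simp: nrm_scale)
  qed
  obtain r t where r: "strict_mono (r::nat \<Rightarrow> nat)" "t \<in> E" "(\<lambda>n. nrm (T (x (r n)) - t)) \<longlonglongrightarrow> 0"
    using T_compact[of x 1] x xE by auto
  obtain n where n: "\<And>k. k \<ge> n \<Longrightarrow> nrm (T (x (r k)) - t) < cmod l / 4"
    using order_tendstoD(2)[OF r(3), of "cmod l / 4"] l by (auto simp: eventually_sequentially)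
  have "nrm (T (x (r n)) - T (x (r (Suc n)))) \<le> nrm (T (x (r n)) - t) + nrm (T (x (r (Suc n))) - t)"
    using nrm_triangle_diff[of "T (x (r n)) - t" "T (x (r (Suc n))) - t"] xE r(2) by simp
  also have "\<dots> < cmod l / 2" using n[of n] n[of "Suc n"] by simp
  finally show False using sep[of "r n" "r (Suc n)"] strict_monoD[OF r(1), of n "Suc n"] by simp
qed

text \<open>The five conclusions are the clauses of the resolvent condition in
  \<open>spectrum_on_B\<close>, so that \<open>l\<close> outside the spectrum can be read
  off.\<close>

theorem Fredholm_alternative:
  obtains R C where "\<And>x. x \<in> E \<Longrightarrow> R x \<in> E"
    and "\<And>x y a b. x \<in> E \<Longrightarrow> y \<in> E \<Longrightarrow> R (a \<odot> x + b \<odot> y) = a \<odot> R x + b \<odot> R y"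
    and "\<And>x. x \<in> E \<Longrightarrow> nrm (R x) \<le> C * nrm x"
    and "\<And>x. x \<in> E \<Longrightarrow> R (T x - l \<odot> x) = x"
    and "\<And>x. x \<in> E \<Longrightarrow> T (R x) - l \<odot> R x = x"
proof -
  have inj_S: "inj_on S E"
  proof (rule inj_onI)
    fix x y assume "x \<in> E" "y \<in> E" "S x = S y"
    then show "x = y" using inj[of "x - y"] by (simp add: S_diff)
  qed
  define R where "R = inv_into E S"
  have R1: "R x \<in> E" if "x \<in> E" for x using that S_surj by (simp add: R_def inv_into_into)
  have R2: "S (R x) = x" if "x \<in> E" for x using that S_surj by (simp add: R_def f_inv_into_f)
  have R3: "R (S x) = x" if "x \<in> E" for x using that inj_S by (simp add: R_def)
  have R4: "R (a \<odot> x + b \<odot> y) = a \<odot> R x + b \<odot> R y" if "x \<in> E" "y \<in> E" for x y a b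
  proof -
    have "a \<odot> x + b \<odot> y = S (a \<odot> R x + b \<odot> R y)"
      using that by (simp add: S_add S_scale R1 R2)
    then show ?thesis using R3 R1 that by simp
  qed
  obtain c where c: "c > 0" "\<And>x. x \<in> E \<Longrightarrow> c * nrm x \<le> nrm (S x)" using S_bounded_below by auto
  have R5: "nrm (R x) \<le> inverse c * nrm x" if "x \<in> E" for x
    using c(2)[OF R1[OF that]] R2[OF that] c(1) by (simp add: field_simps)
  show thesis
    by (rule that[OF R1 R4 R5 R3[unfolded S_def] R2[unfolded S_def]])
qed

end

end

end

section \<open>Super-continuous functions and the transfer operator\<close>

lemma eventually_bounded_imp_bounded:
  fixes x :: "nat \<Rightarrow> real"
  assumes "eventually (\<lambda>m. x m \<le> c) sequentially"
  obtains D where "D \<ge> 0" "\<And>m. x m \<le> D"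
proof -
  obtain M where M: "\<And>m. m \<ge> M \<Longrightarrow> x m \<le> c" using assms by (auto simp: eventually_sequentially)
  show thesis
  proof
    show "0 \<le> \<bar>c\<bar> + (\<Sum>m<M. \<bar>x m\<bar>)" by (simp add: sum_nonneg)
    fix m
    show "x m \<le> \<bar>c\<bar> + (\<Sum>m<M. \<bar>x m\<bar>)"
    proof (cases "m < M")
      case True
      then have "\<bar>x m\<bar> \<le> (\<Sum>m<M. \<bar>x m\<bar>)" by (intro member_le_sum) auto
      then show ?thesis by simp
    next
      case False
      then have "x m \<le> \<bar>c\<bar>" using M[of m] by simp
      moreover have "0 \<le> (\<Sum>m<M. \<bar>x m\<bar>)" by (intro sum_nonneg) simp
      ultimately show ?thesis by linarith
    qed
  qed
qed

text \<open>Mean value inequality on the convex disc of radius \<open>F\<close>, where the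
  derivative of \<open>exp\<close> is bounded by \<open>exp F\<close>.\<close>

lemma norm_exp_diff_le:
  fixes u v :: complex
  assumes "cmod u \<le> F" "cmod v \<le> F"
  shows "cmod (exp u - exp v) \<le> exp F * cmod (u - v)"
proof (rule field_differentiable_bound[of "cball 0 F"])
  show "(exp has_field_derivative exp z) (at z within cball 0 F)" for z :: complex
    by (auto intro!: derivative_eq_intros)
  show "cmod (exp z) \<le> exp F" if "z \<in> cball 0 F" for z :: complex
    using norm_exp[of z] that by (auto intro: order_trans)
qed (use assms in auto)

lemma vector_space_functions: "vector_space (\<lambda>(c::complex) \<phi> w. c * \<phi> w)"
  by standard (auto simp: fun_eq_iff algebra_simps)

text \<open>On an empty space \<open>var\<close> would be minus infinity and \<open>supnorm\<close>
  the supremum of the empty set; nonemptiness makes both nonnegative where they are used.\<close>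

locale shift_space =
  fixes N :: nat and A :: "nat \<Rightarrow> nat \<Rightarrow> nat"
  assumes Sigma_nonempty: "SigmaA N A \<noteq> {}"
begin

lemma var_le_iff:
  "var N A m \<phi> \<le> ereal c \<longleftrightarrow>
     (\<forall>w\<in>SigmaA N A. \<forall>w'\<in>SigmaA N A. (\<forall>k<m. w k = w' k) \<longrightarrow> cmod (\<phi> w - \<phi> w') \<le> c)"
  by (auto simp: var_def SUP_le_iff)

lemma var_nonneg: "0 \<le> var N A m \<phi>"
proof -
  obtain w where "w \<in> SigmaA N A" using Sigma_nonempty by auto
  then have "ereal (cmod (\<phi> (fst (w, w)) - \<phi> (snd (w, w)))) \<le> var N A m \<phi>"
    unfolding var_def by (intro SUP_upper) auto
  then show ?thesis by (simp add: zero_ereal_def)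
qed

lemma ereal_real_var:
  assumes "var N A m \<phi> \<noteq> \<infinity>"
  shows "ereal (real_of_ereal (var N A m \<phi>)) = var N A m \<phi>"
  using assms var_nonneg[of m \<phi>] by (intro ereal_real') auto

lemma real_var_nonneg: "0 \<le> real_of_ereal (var N A m \<phi>)"
  by (simp add: real_of_ereal_pos var_nonneg)

lemma real_var_le: "var N A m \<phi> \<le> ereal c \<Longrightarrow> real_of_ereal (var N A m \<phi>) \<le> c"
  using ereal_real_var[of m \<phi>] by (cases "var N A m \<phi> = \<infinity>") (auto simp flip: ereal_less_eq(3))

text \<open>A sequence has m-th roots tending to 0 exactly when it is dominated by every geometric
  sequence, each with its own constant. Bounds valid for all \<open>m\<close> pass through sums and
  through the transfer operator more easily than limits of roots.\<close>

lemma Vsp_iff: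
  "\<phi> \<in> Vsp N A \<longleftrightarrow>
     \<phi> \<in> ext_funs N A \<and> (\<forall>\<epsilon>>0. \<exists>C\<ge>0. \<forall>m. var N A m \<phi> \<le> ereal (C * \<epsilon> ^ m))"
proof safe
  fix \<epsilon> :: real
  assume \<phi>: "\<phi> \<in> Vsp N A" and \<epsilon>: "0 < \<epsilon>"
  define v where "v m = real_of_ereal (var N A m \<phi>)" for m
  have v: "ereal (v m) = var N A m \<phi>" for m
    using \<phi> ereal_real_var by (auto simp: v_def Vsp_def)
  have v_nonneg: "0 \<le> v m" for m by (simp add: v_def real_var_nonneg)
  have "(\<lambda>m. root m (v m)) \<longlonglongrightarrow> 0" using \<phi> by (simp add: v_def Vsp_def)
  then have "eventually (\<lambda>m. root m (v m) < \<epsilon>) sequentially"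
    using \<epsilon> by (rule order_tendstoD)
  then have "eventually (\<lambda>m. v m / \<epsilon> ^ m \<le> 1) sequentially"
    using eventually_gt_at_top[of 0]
  proof eventually_elim
    case (elim m)
    then have "v m = root m (v m) ^ m" using v_nonneg by simp
    also have "\<dots> \<le> \<epsilon> ^ m" using elim v_nonneg by (intro power_mono) auto
    finally show ?case using \<epsilon> by simp
  qed
  then obtain D where D: "D \<ge> 0" "\<And>m. v m / \<epsilon> ^ m \<le> D"
    by (rule eventually_bounded_imp_bounded) blast
  then have "var N A m \<phi> \<le> ereal (D * \<epsilon> ^ m)" for m
    using \<epsilon> by (simp add: v[symmetric] pos_divide_le_eq)
  then show "\<exists>C\<ge>0. \<forall>m. var N A m \<phi> \<le> ereal (C * \<epsilon> ^ m)" using D by blast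
next
  assume ext: "\<phi> \<in> ext_funs N A"
    and bound: "\<forall>\<epsilon>>0. \<exists>C\<ge>0. \<forall>m. var N A m \<phi> \<le> ereal (C * \<epsilon> ^ m)"
  have fin: "var N A m \<phi> \<noteq> \<infinity>" for m
    using bound[rule_format, of 1] by (auto dest!: spec[of _ m])
  have "(\<lambda>m. root m (real_of_ereal (var N A m \<phi>))) \<longlonglongrightarrow> 0"
  proof (rule LIMSEQ_I)
    fix \<epsilon> :: real assume \<epsilon>: "0 < \<epsilon>"
    obtain C where C: "C \<ge> 0" "\<And>m. var N A m \<phi> \<le> ereal (C * (\<epsilon>/2) ^ m)"
      using bound[rule_format, of "\<epsilon>/2"] \<epsilon> by auto
    \<comment> \<open>The roots of a positive constant tend to 1, hence \<open>C + 1\<close> in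
      place of \<open>C\<close>. The resulting factor 2 is compensated by the rate
      \<open>\<epsilon>/2\<close>.\<close>
    have "eventually (\<lambda>m. root m (C + 1) < 2) sequentially"
      using C(1) by (intro order_tendstoD(2)[OF LIMSEQ_root_const]) auto
    then have "eventually (\<lambda>m. norm (root m (real_of_ereal (var N A m \<phi>)) - 0) < \<epsilon>) sequentially"
      using eventually_gt_at_top[of 0]
    proof eventually_elim
      case (elim m)
      have "real_of_ereal (var N A m \<phi>) \<le> C * (\<epsilon>/2) ^ m" using C(2) by (rule real_var_le)
      also have "\<dots> \<le> (C + 1) * (\<epsilon>/2) ^ m" using \<epsilon> by (intro mult_right_mono) auto
      finally have "root m (real_of_ereal (var N A m \<phi>)) \<le> root m ((C + 1) * (\<epsilon>/2) ^ m)"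
        using elim by (intro real_root_le_mono) auto
      also have "\<dots> = root m (C + 1) * (\<epsilon>/2)"
        using elim \<epsilon> by (simp add: real_root_mult real_root_power_cancel)
      also have "\<dots> < 2 * (\<epsilon>/2)" using elim \<epsilon> by (intro mult_strict_right_mono) auto
      finally show ?case using real_var_nonneg[of m \<phi>] elim by (simp add: real_root_ge_zero)
    qed
    then show "\<exists>n. \<forall>m\<ge>n. norm (root m (real_of_ereal (var N A m \<phi>)) - 0) < \<epsilon>"
      by (simp add: eventually_sequentially)
  qed
  then show "\<phi> \<in> Vsp N A" using ext fin by (simp add: Vsp_def)
qed (simp add: Vsp_def)

lemma bounded_of_var_0:
  assumes "var N A 0 \<phi> \<le> ereal c"
  obtains a where "a \<ge> 0" "\<And>w. w \<in> SigmaA N A \<Longrightarrow> cmod (\<phi> w) \<le> a"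
proof -
  obtain v where v: "v \<in> SigmaA N A" using Sigma_nonempty by auto
  show thesis
  proof
    show "0 \<le> cmod (\<phi> v) + \<bar>c\<bar>" by simp
    fix w assume w: "w \<in> SigmaA N A"
    have "cmod (\<phi> w - \<phi> v) \<le> c" using assms w v by (simp add: var_le_iff)
    then show "cmod (\<phi> w) \<le> cmod (\<phi> v) + \<bar>c\<bar>" using norm_triangle_sub[of "\<phi> w" "\<phi> v"] by simp
  qed
qed

lemma Vsp_bounded:
  assumes "\<phi> \<in> Vsp N A"
  obtains a where "a \<ge> 0" "\<And>w. w \<in> SigmaA N A \<Longrightarrow> cmod (\<phi> w) \<le> a"
proof -
  have "\<exists>C\<ge>0. \<forall>m. var N A m \<phi> \<le> ereal (C * 1 ^ m)" using assms unfolding Vsp_iff by (meson zero_less_one)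
  then obtain C where "var N A 0 \<phi> \<le> ereal (C * 1 ^ 0)" by blast
  then show thesis using that bounded_of_var_0 by blast
qed

lemma ext_funs_combination:
  "\<phi> \<in> ext_funs N A \<Longrightarrow> \<psi> \<in> ext_funs N A \<Longrightarrow> (\<lambda>w. a * \<phi> w + b * \<psi> w) \<in> ext_funs N A"
  by (simp add: ext_funs_def)

lemma var_combination:
  assumes "var N A m \<phi> \<le> ereal c" "var N A m \<psi> \<le> ereal d"
  shows "var N A m (\<lambda>w. a * \<phi> w + b * \<psi> w) \<le> ereal (cmod a * c + cmod b * d)"
  unfolding var_le_iff
proof (intro ballI impI)
  fix w w' assume w: "w \<in> SigmaA N A" "w' \<in> SigmaA N A" "\<forall>k<m. w k = w' k"
  have "cmod ((a * \<phi> w + b * \<psi> w) - (a * \<phi> w' + b * \<psi> w')) = cmod (a * (\<phi> w - \<phi> w') + b * (\<psi> w - \<psi> w'))"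
    by (simp add: algebra_simps)
  also have "\<dots> \<le> cmod a * cmod (\<phi> w - \<phi> w') + cmod b * cmod (\<psi> w - \<psi> w')"
    by (metis norm_mult norm_triangle_ineq)
  also have "\<dots> \<le> cmod a * c + cmod b * d"
    using assms w by (intro add_mono mult_left_mono) (auto simp: var_le_iff)
  finally show "cmod ((a * \<phi> w + b * \<psi> w) - (a * \<phi> w' + b * \<psi> w')) \<le> cmod a * c + cmod b * d" .
qed

lemma Vsp_combination:
  assumes "\<phi> \<in> Vsp N A" "\<psi> \<in> Vsp N A"
  shows "(\<lambda>w. a * \<phi> w + b * \<psi> w) \<in> Vsp N A"
  unfolding Vsp_iff
proof (intro conjI allI impI)
  show "(\<lambda>w. a * \<phi> w + b * \<psi> w) \<in> ext_funs N A"
    using assms by (intro ext_funs_combination) (simp_all add: Vsp_def)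
  fix \<epsilon> :: real assume "0 < \<epsilon>"
  then obtain C D where CD: "C \<ge> 0" "\<And>m. var N A m \<phi> \<le> ereal (C * \<epsilon> ^ m)"
    "D \<ge> 0" "\<And>m. var N A m \<psi> \<le> ereal (D * \<epsilon> ^ m)"
    using assms unfolding Vsp_iff by meson
  show "\<exists>C\<ge>0. \<forall>m. var N A m (\<lambda>w. a * \<phi> w + b * \<psi> w) \<le> ereal (C * \<epsilon> ^ m)"
  proof (intro exI[of _ "cmod a * C + cmod b * D"] conjI allI)
    fix m
    show "var N A m (\<lambda>w. a * \<phi> w + b * \<psi> w) \<le> ereal ((cmod a * C + cmod b * D) * \<epsilon> ^ m)"
      using var_combination[OF CD(2,4), of m a b] by (simp add: algebra_simps)
  qed (use CD in simp)
qed

section \<open>The transfer operator as a sum over prepended symbols\<close>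

lemma shift_in_Sigma: "w \<in> SigmaA N A \<Longrightarrow> shift w \<in> SigmaA N A"
  by (auto simp: SigmaA_def shift_def)

lemma case_nat_in_Sigma_iff:
  assumes "w \<in> SigmaA N A"
  shows "case_nat a w \<in> SigmaA N A \<longleftrightarrow> a \<in> {1..N} \<and> A a (w 0) = 1"
proof
  assume h: "case_nat a w \<in> SigmaA N A"
  then have "case_nat a w 0 \<in> {1..N}" "A (case_nat a w 0) (case_nat a w (Suc 0)) = 1"
    unfolding SigmaA_def by blast+
  then show "a \<in> {1..N} \<and> A a (w 0) = 1" by simp
next
  assume "a \<in> {1..N} \<and> A a (w 0) = 1"
  then show "case_nat a w \<in> SigmaA N A"
    using assms by (auto simp: SigmaA_def split: nat.split)
qed

lemma transfer_in_ext_funs: "transfer N A f \<phi> \<in> ext_funs N A"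
proof -
  have "{w'. w' \<in> SigmaA N A \<and> shift w' = w} = {}" if "w \<notin> SigmaA N A" for w
    using that shift_in_Sigma by auto
  then show ?thesis unfolding ext_funs_def transfer_def by (auto intro!: sum.neutral)
qed

text \<open>The point \<open>case_nat a w\<close> is \<open>w\<close> with \<open>a\<close>
  prepended. The index set depends on \<open>w\<close> only through \<open>w 0\<close>, so the sums
  at two points with the same first symbol can be compared term by term.\<close>

lemma transfer_eq_sum:
  assumes w: "w \<in> SigmaA N A"
  shows "transfer N A f \<phi> w =
    (\<Sum>a\<in>{a\<in>{1..N}. A a (w 0) = 1}. exp (f (case_nat a w)) * \<phi> (case_nat a w))"
proof -
  have "{w'. w' \<in> SigmaA N A \<and> shift w' = w} = (\<lambda>a. case_nat a w) ` {a\<in>{1..N}. A a (w 0) = 1}"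
  proof (intro equalityI subsetI)
    fix w' assume "w' \<in> {w'. w' \<in> SigmaA N A \<and> shift w' = w}"
    then have w': "w' \<in> SigmaA N A" "shift w' = w" by auto
    then have "w' = case_nat (w' 0) w" by (auto simp: fun_eq_iff shift_def split: nat.split)
    then show "w' \<in> (\<lambda>a. case_nat a w) ` {a\<in>{1..N}. A a (w 0) = 1}"
      using case_nat_in_Sigma_iff[OF w, of "w' 0"] w' by auto
  next
    fix w' assume "w' \<in> (\<lambda>a. case_nat a w) ` {a\<in>{1..N}. A a (w 0) = 1}"
    then show "w' \<in> {w'. w' \<in> SigmaA N A \<and> shift w' = w}"
      using case_nat_in_Sigma_iff[OF w] by (auto simp: shift_def)
  qed
  moreover have "inj_on (\<lambda>a. case_nat a w) {a\<in>{1..N}. A a (w 0) = 1}"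
  proof (rule inj_onI)
    fix a b :: nat assume "case_nat a w = case_nat b w"
    from fun_cong[OF this, of 0] show "a = b" by simp
  qed
  ultimately show ?thesis by (simp add: transfer_def sum.reindex)
qed

lemma transfer_linear:
  "transfer N A f (\<lambda>w. a * \<phi> w + b * \<psi> w) = (\<lambda>w. a * transfer N A f \<phi> w + b * transfer N A f \<psi> w)"
  by (simp add: transfer_def sum_distrib_left sum.distrib[symmetric] algebra_simps fun_eq_iff)

text \<open>One constant serves all \<open>\<phi>\<close> and \<open>m\<close>. Prepending a symbol
  lengthens a common prefix of length \<open>m\<close> to \<open>Suc m\<close>, which accounts for
  the shifted variations; \<open>1 \<le> m\<close> guarantees that both points admit the same
  symbols.\<close>

lemma transfer_estimates:
  assumes f: "f \<in> Vsp N A"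
  obtains K where "K > 0"
    and "\<And>\<phi> a w. (\<And>w. w \<in> SigmaA N A \<Longrightarrow> cmod (\<phi> w) \<le> a) \<Longrightarrow> w \<in> SigmaA N A \<Longrightarrow>
           cmod (transfer N A f \<phi> w) \<le> K * a"
    and "\<And>\<phi> a b c m. (\<And>w. w \<in> SigmaA N A \<Longrightarrow> cmod (\<phi> w) \<le> a) \<Longrightarrow> 1 \<le> m \<Longrightarrow>
           var N A (Suc m) f \<le> ereal b \<Longrightarrow> var N A (Suc m) \<phi> \<le> ereal c \<Longrightarrow>
           var N A m (transfer N A f \<phi>) \<le> ereal (K * (a * b + c))"
proof -
  obtain F where F: "\<And>w. w \<in> SigmaA N A \<Longrightarrow> cmod (f w) \<le> F" using Vsp_bounded[OF f] by blast
  \<comment> \<open>\<open>exp F\<close> bounds each weight and \<open>real N + 1\<close> the number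
    of preimages; the summand 1 makes positivity of \<open>K\<close> immediate.\<close>
  define K where "K = (real N + 1) * exp F"
  have K: "K > 0" by (simp add: K_def)
  have exp_le: "cmod (exp (f w)) \<le> exp F" if "w \<in> SigmaA N A" for w
    using F[OF that] norm_exp[of "f w"] by (auto intro: order_trans)
  have sum_le: "cmod (\<Sum>a\<in>{a\<in>{1..N}. A a i = 1}. h a) \<le> (real N + 1) * B"
    if h: "\<And>a. a \<in> {a\<in>{1..N}. A a i = 1} \<Longrightarrow> cmod (h a) \<le> B" and B: "B \<ge> 0" for h B i
  proof -
    have "cmod (\<Sum>a\<in>{a\<in>{1..N}. A a i = 1}. h a) \<le> real (card {a\<in>{1..N}. A a i = 1}) * B"
      by (rule sum_norm_bound[OF h])
    also have "\<dots> \<le> (real N + 1) * B"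
    proof (rule mult_right_mono[OF _ B])
      have "card {a\<in>{1..N}. A a i = 1} \<le> card {1..N}" by (rule card_mono) auto
      then show "real (card {a\<in>{1..N}. A a i = 1}) \<le> real N + 1" by simp
    qed
    finally show ?thesis .
  qed
  have nonneg: "0 \<le> a" if "\<And>w. w \<in> SigmaA N A \<Longrightarrow> cmod (\<phi> w) \<le> a" for a and \<phi> :: "(nat \<Rightarrow> nat) \<Rightarrow> complex"
    using that Sigma_nonempty norm_ge_zero order_trans by (metis ex_in_conv)
  have 1: "cmod (transfer N A f \<phi> w) \<le> K * a"
    if a: "\<And>w. w \<in> SigmaA N A \<Longrightarrow> cmod (\<phi> w) \<le> a" and w: "w \<in> SigmaA N A" for \<phi> a w
  proof -
    have "cmod (transfer N A f \<phi> w) \<le> (real N + 1) * (exp F * a)"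
      unfolding transfer_eq_sum[OF w]
      using exp_le a case_nat_in_Sigma_iff[OF w] nonneg[OF a]
      by (intro sum_le) (auto simp: norm_mult intro!: mult_mono)
    then show ?thesis by (simp add: K_def mult.assoc)
  qed
  have 2: "var N A m (transfer N A f \<phi>) \<le> ereal (K * (a * b + c))"
    if a: "\<And>w. w \<in> SigmaA N A \<Longrightarrow> cmod (\<phi> w) \<le> a" and m: "1 \<le> m"
      and b: "var N A (Suc m) f \<le> ereal b" and c: "var N A (Suc m) \<phi> \<le> ereal c" for \<phi> a b c m
    unfolding var_le_iff
  proof (intro ballI impI)
    fix w w' assume w: "w \<in> SigmaA N A" "w' \<in> SigmaA N A" and eq: "\<forall>k<m. w k = w' k"
    have w0: "w' 0 = w 0" using eq m by auto
    have bc: "0 \<le> b" "0 \<le> c" using b c var_nonneg order_trans by (metis ereal_less_eq(5))+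
    have "cmod (exp (f (case_nat i w)) * \<phi> (case_nat i w) - exp (f (case_nat i w')) * \<phi> (case_nat i w'))
        \<le> exp F * (a * b + c)" if i: "i \<in> {i\<in>{1..N}. A i (w 0) = 1}" for i
    proof -
      define x y where "x = case_nat i w" and "y = case_nat i w'"
      have xy: "x \<in> SigmaA N A" "y \<in> SigmaA N A"
        using case_nat_in_Sigma_iff[OF w(1), of i] case_nat_in_Sigma_iff[OF w(2), of i] i w0
        by (auto simp: x_def y_def)
      have agree: "\<forall>k<Suc m. x k = y k" using eq by (auto simp: x_def y_def split: nat.split)
      have "cmod (exp (f x) - exp (f y)) \<le> exp F * cmod (f x - f y)"
        using F xy by (intro norm_exp_diff_le) auto
      also have "\<dots> \<le> exp F * b"
        using b xy agree by (intro mult_left_mono) (auto simp: var_le_iff)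
      finally have f_diff: "cmod (exp (f x) - exp (f y)) \<le> exp F * b" .
      have \<phi>_diff: "cmod (\<phi> x - \<phi> y) \<le> c" using c xy agree by (simp add: var_le_iff)
      have "exp (f x) * \<phi> x - exp (f y) * \<phi> y = (exp (f x) - exp (f y)) * \<phi> x + exp (f y) * (\<phi> x - \<phi> y)"
        by (simp add: algebra_simps)
      then have "cmod (exp (f x) * \<phi> x - exp (f y) * \<phi> y)
          \<le> cmod (exp (f x) - exp (f y)) * cmod (\<phi> x) + cmod (exp (f y)) * cmod (\<phi> x - \<phi> y)"
        by (metis norm_mult norm_triangle_ineq)
      also have "\<dots> \<le> (exp F * b) * a + exp F * c"
        using f_diff \<phi>_diff a xy exp_le bc by (intro add_mono mult_mono) auto
      finally show ?thesis by (simp add: x_def y_def algebra_simps)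
    qed
    then have "cmod (transfer N A f \<phi> w - transfer N A f \<phi> w') \<le> (real N + 1) * (exp F * (a * b + c))"
      unfolding transfer_eq_sum[OF w(1)] transfer_eq_sum[OF w(2)] w0 sum_subtractf[symmetric]
      using bc nonneg[OF a] by (intro sum_le) auto
    then show "cmod (transfer N A f \<phi> w - transfer N A f \<phi> w') \<le> K * (a * b + c)"
      by (simp add: K_def mult.assoc)
  qed
  show thesis using that[OF K 1 2] by blast
qed

lemma transfer_Vsp:
  assumes f: "f \<in> Vsp N A" and \<phi>: "\<phi> \<in> Vsp N A"
  shows "transfer N A f \<phi> \<in> Vsp N A"
  unfolding Vsp_iff
proof (intro conjI allI impI transfer_in_ext_funs)
  fix \<epsilon> :: real assume \<epsilon>: "0 < \<epsilon>"
  obtain K where K: "K > 0"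
    "\<And>\<phi> a w. (\<And>w. w \<in> SigmaA N A \<Longrightarrow> cmod (\<phi> w) \<le> a) \<Longrightarrow> w \<in> SigmaA N A \<Longrightarrow>
           cmod (transfer N A f \<phi> w) \<le> K * a"
    "\<And>\<phi> a b c m. (\<And>w. w \<in> SigmaA N A \<Longrightarrow> cmod (\<phi> w) \<le> a) \<Longrightarrow> 1 \<le> m \<Longrightarrow>
           var N A (Suc m) f \<le> ereal b \<Longrightarrow> var N A (Suc m) \<phi> \<le> ereal c \<Longrightarrow>
           var N A m (transfer N A f \<phi>) \<le> ereal (K * (a * b + c))"
    using transfer_estimates[OF f] by blast
  obtain a where a: "a \<ge> 0" "\<And>w. w \<in> SigmaA N A \<Longrightarrow> cmod (\<phi> w) \<le> a" using Vsp_bounded[OF \<phi>] by blast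
  obtain B C where BC: "B \<ge> 0" "\<And>m. var N A m f \<le> ereal (B * \<epsilon> ^ m)"
    "C \<ge> 0" "\<And>m. var N A m \<phi> \<le> ereal (C * \<epsilon> ^ m)"
    using f \<phi> \<epsilon> unfolding Vsp_iff by meson
  \<comment> \<open>The first entry covers \<open>m = 0\<close>, where only twice the sup bound is
    available; in the second, the last \<open>\<epsilon>\<close> is the factor split off from
    \<open>\<epsilon> ^ Suc m\<close>.\<close>
  define D where "D = max (2 * (K * a)) (K * (a * B + C) * \<epsilon>)"
  have "var N A m (transfer N A f \<phi>) \<le> ereal (D * \<epsilon> ^ m)" for m
  proof (cases "m = 0")
    case True
    have "cmod (transfer N A f \<phi> w - transfer N A f \<phi> w') \<le> 2 * (K * a)"
      if "w \<in> SigmaA N A" "w' \<in> SigmaA N A" for w w'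
      using norm_triangle_ineq4[of "transfer N A f \<phi> w" "transfer N A f \<phi> w'"]
        K(2)[of \<phi> a, OF a(2) that(1)] K(2)[of \<phi> a, OF a(2) that(2)] by linarith
    then have "var N A 0 (transfer N A f \<phi>) \<le> ereal (2 * (K * a))" by (simp add: var_le_iff)
    also have "\<dots> \<le> ereal (D * \<epsilon> ^ 0)" by (simp add: D_def)
    finally show ?thesis using True by simp
  next
    case False
    then have "var N A m (transfer N A f \<phi>) \<le> ereal (K * (a * (B * \<epsilon> ^ Suc m) + C * \<epsilon> ^ Suc m))"
      using False by (intro K(3) a(2) BC(2,4)) auto
    also have "\<dots> \<le> ereal (D * \<epsilon> ^ m)"
    proof -
      have "(K * (a * B + C) * \<epsilon>) * \<epsilon> ^ m \<le> D * \<epsilon> ^ m"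
        using \<epsilon> by (intro mult_right_mono) (auto simp: D_def)
      then show ?thesis by (simp add: algebra_simps)
    qed
    finally show ?thesis .
  qed
  moreover have "D \<ge> 0" using K a by (simp add: D_def le_max_iff_disj)
  ultimately show "\<exists>C\<ge>0. \<forall>m. var N A m (transfer N A f \<phi>) \<le> ereal (C * \<epsilon> ^ m)" by blast
qed

end

section \<open>The graded space\<close>

locale graded_shift_space = shift_space +
  fixes \<theta> :: "nat \<Rightarrow> real"
  assumes \<theta>_Suc_le: "m \<ge> 1 \<Longrightarrow> \<theta> (Suc m) \<le> \<theta> m"
    and \<theta>_nonneg: "m \<ge> 1 \<Longrightarrow> 0 \<le> \<theta> m"
    and \<theta>_tendsto: "\<theta> \<longlonglongrightarrow> 0"
begin

lemma \<theta>_antimono: "1 \<le> m \<Longrightarrow> m \<le> n \<Longrightarrow> \<theta> n \<le> \<theta> m"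
proof (induction n)
  case (Suc n)
  then show ?case using \<theta>_Suc_le[of n] by (cases "m = Suc n") auto
qed simp

lemma \<theta>_power_nonneg: "0 \<le> \<theta> (Suc m) ^ m"
  by (simp add: \<theta>_nonneg)

lemma \<theta>_Suc_tendsto: "(\<lambda>m. \<theta> (Suc m)) \<longlonglongrightarrow> 0"
  using \<theta>_tendsto by (rule LIMSEQ_Suc)

lemma eventually_mult_\<theta>_le: "0 < \<epsilon> \<Longrightarrow> eventually (\<lambda>m. c * \<theta> (Suc m) \<le> \<epsilon>) sequentially"
  using order_tendstoD(2)[OF tendsto_mult_right_zero[OF \<theta>_Suc_tendsto, of c], of \<epsilon>]
  by (auto elim: eventually_mono)

text \<open>Since \<open>\<theta> (Suc m)\<close> is eventually below \<open>\<epsilon>\<close>, the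
  quotient of the two powers is eventually at most 1; \<open>D\<close> absorbs the remaining
  finitely many levels.\<close>

lemma \<theta>_power_le_geometric:
  assumes "0 < \<epsilon>"
  obtains D where "D \<ge> 0" "\<And>m. \<theta> (Suc m) ^ m \<le> D * \<epsilon> ^ m"
proof -
  have "eventually (\<lambda>m. \<theta> (Suc m) ^ m / \<epsilon> ^ m \<le> 1) sequentially"
    using eventually_mult_\<theta>_le[OF assms, of 1]
  proof eventually_elim
    case (elim m)
    then have "\<theta> (Suc m) ^ m \<le> \<epsilon> ^ m" by (intro power_mono) (auto simp: \<theta>_nonneg)
    then show ?case using assms by simp
  qed
  then obtain D where "D \<ge> 0" "\<And>m. \<theta> (Suc m) ^ m / \<epsilon> ^ m \<le> D"
    by (rule eventually_bounded_imp_bounded) blast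
  then show thesis using assms by (intro that[of D]) (auto simp: pos_divide_le_eq)
qed

text \<open>The weights decay faster than every geometric sequence, so a single variation bound
  already gives super-continuity.\<close>

lemma Bsp_iff:
  "\<phi> \<in> Bsp N A \<theta> \<longleftrightarrow>
     \<phi> \<in> ext_funs N A \<and> (\<exists>C\<ge>0. \<forall>m. var N A m \<phi> \<le> ereal (C * \<theta> (Suc m) ^ m))"
proof
  assume "\<phi> \<in> Bsp N A \<theta>"
  then show "\<phi> \<in> ext_funs N A \<and> (\<exists>C\<ge>0. \<forall>m. var N A m \<phi> \<le> ereal (C * \<theta> (Suc m) ^ m))"
    by (simp add: Bsp_def Vsp_def)
next
  assume R: "\<phi> \<in> ext_funs N A \<and> (\<exists>C\<ge>0. \<forall>m. var N A m \<phi> \<le> ereal (C * \<theta> (Suc m) ^ m))"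
  then obtain C where C: "C \<ge> 0" "\<And>m. var N A m \<phi> \<le> ereal (C * \<theta> (Suc m) ^ m)" by blast
  have "\<exists>C\<ge>0. \<forall>m. var N A m \<phi> \<le> ereal (C * \<epsilon> ^ m)" if \<epsilon>: "0 < \<epsilon>" for \<epsilon>
  proof -
    obtain D where D: "D \<ge> 0" "\<And>m. \<theta> (Suc m) ^ m \<le> D * \<epsilon> ^ m" using \<theta>_power_le_geometric[OF \<epsilon>] by blast
    have "var N A m \<phi> \<le> ereal (C * D * \<epsilon> ^ m)" for m
      using C(2)[of m] mult_left_mono[OF D(2)[of m] C(1)] by (auto simp: mult.assoc intro: order_trans)
    then show ?thesis using C D by (intro exI[of _ "C * D"]) auto
  qed
  then show "\<phi> \<in> Bsp N A \<theta>" using R by (simp add: Bsp_def Vsp_iff)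
qed

lemma BspI:
  assumes "\<phi> \<in> ext_funs N A" "0 \<le> C" "\<And>m. var N A m \<phi> \<le> ereal (C * \<theta> (Suc m) ^ m)"
  shows "\<phi> \<in> Bsp N A \<theta>"
  using assms by (auto simp: Bsp_iff)

lemma Bsp_imp_Vsp: "\<phi> \<in> Bsp N A \<theta> \<Longrightarrow> \<phi> \<in> Vsp N A"
  by (simp add: Bsp_def)

definition seminorm :: "((nat \<Rightarrow> nat) \<Rightarrow> complex) \<Rightarrow> real" where
  "seminorm \<phi> = Inf {C. C \<ge> 0 \<and> (\<forall>m. var N A m \<phi> \<le> ereal (C * \<theta> (Suc m) ^ m))}"

lemma Bnorm_eq: "Bnorm N A \<theta> \<phi> = supnorm N A \<phi> + seminorm \<phi>"
  by (simp add: Bnorm_def seminorm_def)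

lemma seminorm_le:
  "0 \<le> C \<Longrightarrow> (\<And>m. var N A m \<phi> \<le> ereal (C * \<theta> (Suc m) ^ m)) \<Longrightarrow> seminorm \<phi> \<le> C"
  unfolding seminorm_def by (intro cInf_lower bdd_belowI[of _ 0]) auto

lemma seminorm_nonneg: "\<phi> \<in> Bsp N A \<theta> \<Longrightarrow> 0 \<le> seminorm \<phi>"
  unfolding seminorm_def Bsp_iff by (intro cInf_greatest) auto

text \<open>The infimum is attained: where the weight is positive, divide by it and pass to the
  infimum over all admissible constants; where it is 0, any admissible constant gives the same bound
  0.\<close>

lemma var_le_seminorm:
  assumes "\<phi> \<in> Bsp N A \<theta>"
  shows "var N A m \<phi> \<le> ereal (seminorm \<phi> * \<theta> (Suc m) ^ m)"
proof (cases "\<theta> (Suc m) ^ m = 0")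
  case True
  obtain C where "var N A m \<phi> \<le> ereal (C * \<theta> (Suc m) ^ m)" using assms by (auto simp: Bsp_iff)
  then show ?thesis by (simp only: True mult_zero_right)
next
  case False
  then have pos: "0 < \<theta> (Suc m) ^ m" using \<theta>_power_nonneg[of m] by linarith
  show ?thesis unfolding var_le_iff
  proof (intro ballI impI)
    fix w w' assume w: "w \<in> SigmaA N A" "w' \<in> SigmaA N A" "\<forall>k<m. w k = w' k"
    have "cmod (\<phi> w - \<phi> w') / \<theta> (Suc m) ^ m \<le> seminorm \<phi>"
      unfolding seminorm_def
    proof (rule cInf_greatest)
      show "{C. 0 \<le> C \<and> (\<forall>m. var N A m \<phi> \<le> ereal (C * \<theta> (Suc m) ^ m))} \<noteq> {}"
        using assms by (auto simp: Bsp_iff)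
      fix C assume "C \<in> {C. 0 \<le> C \<and> (\<forall>m. var N A m \<phi> \<le> ereal (C * \<theta> (Suc m) ^ m))}"
      then have "var N A m \<phi> \<le> ereal (C * \<theta> (Suc m) ^ m)" by blast
      then show "cmod (\<phi> w - \<phi> w') / \<theta> (Suc m) ^ m \<le> C"
        using w pos by (simp add: var_le_iff pos_divide_le_eq)
    qed
    then show "cmod (\<phi> w - \<phi> w') \<le> seminorm \<phi> * \<theta> (Suc m) ^ m"
      using pos by (simp add: pos_divide_le_eq)
  qed
qed

lemma supnorm_le: "(\<And>w. w \<in> SigmaA N A \<Longrightarrow> cmod (\<phi> w) \<le> a) \<Longrightarrow> supnorm N A \<phi> \<le> a"
  unfolding supnorm_def using Sigma_nonempty by (intro cSup_least) auto

lemma cmod_le_supnorm: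
  assumes "\<phi> \<in> Bsp N A \<theta>" "w \<in> SigmaA N A"
  shows "cmod (\<phi> w) \<le> supnorm N A \<phi>"
proof -
  obtain a where "\<And>w. w \<in> SigmaA N A \<Longrightarrow> cmod (\<phi> w) \<le> a"
    using Vsp_bounded[OF Bsp_imp_Vsp[OF assms(1)]] by blast
  then show ?thesis unfolding supnorm_def using assms(2) by (intro cSup_upper bdd_aboveI[of _ a]) auto
qed

lemma supnorm_nonneg: "\<phi> \<in> Bsp N A \<theta> \<Longrightarrow> 0 \<le> supnorm N A \<phi>"
  using cmod_le_supnorm Sigma_nonempty norm_ge_zero order_trans by (metis ex_in_conv)

lemma Bnorm_le:
  assumes "\<And>w. w \<in> SigmaA N A \<Longrightarrow> cmod (\<phi> w) \<le> a"
    and "0 \<le> b" "\<And>m. var N A m \<phi> \<le> ereal (b * \<theta> (Suc m) ^ m)"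
  shows "Bnorm N A \<theta> \<phi> \<le> a + b"
  unfolding Bnorm_eq using assms by (intro add_mono supnorm_le seminorm_le) auto

lemma
  assumes "\<phi> \<in> Bsp N A \<theta>" "\<psi> \<in> Bsp N A \<theta>"
  shows Bsp_combination: "(\<lambda>w. a * \<phi> w + b * \<psi> w) \<in> Bsp N A \<theta>" (is ?in)
    and Bnorm_combination:
      "Bnorm N A \<theta> (\<lambda>w. a * \<phi> w + b * \<psi> w) \<le> cmod a * Bnorm N A \<theta> \<phi> + cmod b * Bnorm N A \<theta> \<psi>" (is ?le)
proof -
  define c where "c = cmod a * seminorm \<phi> + cmod b * seminorm \<psi>"
  have c: "0 \<le> c" using assms by (simp add: c_def seminorm_nonneg)
  have var_c: "var N A m (\<lambda>w. a * \<phi> w + b * \<psi> w) \<le> ereal (c * \<theta> (Suc m) ^ m)" for m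
    using var_combination[OF var_le_seminorm[OF assms(1)] var_le_seminorm[OF assms(2)], of m a b]
    by (simp add: c_def algebra_simps)
  have "(\<lambda>w. a * \<phi> w + b * \<psi> w) \<in> ext_funs N A"
    using assms by (intro ext_funs_combination) (simp_all add: Bsp_iff)
  then show ?in using c var_c by (rule BspI)
  have "cmod (a * \<phi> w + b * \<psi> w) \<le> cmod a * supnorm N A \<phi> + cmod b * supnorm N A \<psi>"
    if "w \<in> SigmaA N A" for w
  proof -
    have "cmod (a * \<phi> w + b * \<psi> w) \<le> cmod a * cmod (\<phi> w) + cmod b * cmod (\<psi> w)"
      by (metis norm_mult norm_triangle_ineq)
    then show ?thesis
      using mult_left_mono[OF cmod_le_supnorm[OF assms(1) that], of "cmod a"]
        mult_left_mono[OF cmod_le_supnorm[OF assms(2) that], of "cmod b"] by simp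
  qed
  from Bnorm_le[OF this c var_c] show ?le by (simp add: Bnorm_eq c_def algebra_simps)
qed

lemma Bsp_zero: "(\<lambda>w. 0) \<in> Bsp N A \<theta>"
  by (rule BspI[of _ 0]) (auto simp: ext_funs_def var_le_iff)

lemma Bnorm_nonneg: "\<phi> \<in> Bsp N A \<theta> \<Longrightarrow> 0 \<le> Bnorm N A \<theta> \<phi>"
  by (simp add: Bnorm_eq supnorm_nonneg seminorm_nonneg)

lemma Bsp_eq_0:
  assumes \<phi>: "\<phi> \<in> Bsp N A \<theta>" and 0: "Bnorm N A \<theta> \<phi> = 0"
  shows "\<phi> = (\<lambda>w. 0)"
proof
  fix w
  have "supnorm N A \<phi> = 0" using 0 supnorm_nonneg[OF \<phi>] seminorm_nonneg[OF \<phi>] by (simp add: Bnorm_eq)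
  then show "\<phi> w = 0"
    using cmod_le_supnorm[OF \<phi>, of w] \<phi> by (cases "w \<in> SigmaA N A") (auto simp: Bsp_iff ext_funs_def)
qed

lemma Bnorm_scale:
  assumes "\<phi> \<in> Bsp N A \<theta>"
  shows "Bnorm N A \<theta> (\<lambda>w. c * \<phi> w) = cmod c * Bnorm N A \<theta> \<phi>"
proof -
  have le: "Bnorm N A \<theta> (\<lambda>w. c * \<psi> w) \<le> cmod c * Bnorm N A \<theta> \<psi>" if "\<psi> \<in> Bsp N A \<theta>" for c \<psi>
    using Bnorm_combination[OF that that, of c 0] by simp
  have in_B: "(\<lambda>w. c * \<phi> w) \<in> Bsp N A \<theta>" using Bsp_combination[OF assms assms, of c 0] by simp
  show ?thesis
  proof (cases "c = 0")
    case True
    then show ?thesis using le[OF assms, of c] Bnorm_nonneg[OF in_B] by simp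
  next
    case False
    have "Bnorm N A \<theta> \<phi> \<le> cmod (inverse c) * Bnorm N A \<theta> (\<lambda>w. c * \<phi> w)"
      using le[OF in_B, of "inverse c"] False by (simp add: mult.assoc[symmetric])
    then have "cmod c * Bnorm N A \<theta> \<phi> \<le> Bnorm N A \<theta> (\<lambda>w. c * \<phi> w)"
      using False by (simp add: norm_inverse norm_divide field_simps)
    then show ?thesis using le[OF assms, of c] by simp
  qed
qed

lemma normed_subspace_Bsp: "normed_subspace (\<lambda>(c::complex) \<phi> w. c * \<phi> w) (Bsp N A \<theta>) (Bnorm N A \<theta>)"
proof -
  interpret V: vector_space "\<lambda>(c::complex) (\<phi>::(nat \<Rightarrow> nat) \<Rightarrow> complex) w. c * \<phi> w"
    by (rule vector_space_functions)
  show ?thesis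
  proof
    show "V.subspace (Bsp N A \<theta>)"
    proof (rule V.subspaceI)
      show "0 \<in> Bsp N A \<theta>" using Bsp_zero by (simp add: zero_fun_def)
    next
      fix \<phi> \<psi> assume "\<phi> \<in> Bsp N A \<theta>" "\<psi> \<in> Bsp N A \<theta>"
      from Bsp_combination[OF this, of 1 1] show "\<phi> + \<psi> \<in> Bsp N A \<theta>" by (simp add: plus_fun_def)
    next
      fix c and \<phi> assume "\<phi> \<in> Bsp N A \<theta>"
      from Bsp_combination[OF this this, of c 0] show "(\<lambda>w. c * \<phi> w) \<in> Bsp N A \<theta>" by simp
    qed
  next
    fix \<phi> \<psi> assume "\<phi> \<in> Bsp N A \<theta>" "\<psi> \<in> Bsp N A \<theta>"
    from Bnorm_combination[OF this, of 1 1]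
    show "Bnorm N A \<theta> (\<phi> + \<psi>) \<le> Bnorm N A \<theta> \<phi> + Bnorm N A \<theta> \<psi>" by (simp add: plus_fun_def)
  next
    fix \<phi> assume "\<phi> \<in> Bsp N A \<theta>" "Bnorm N A \<theta> \<phi> = 0"
    then show "\<phi> = 0" using Bsp_eq_0 by (simp add: zero_fun_def)
  qed (rule Bnorm_scale)
qed

section \<open>Arzela-Ascoli and the compact inclusion\<close>

lemma finite_prefix_net:
  obtains R where "finite R" "R \<subseteq> SigmaA N A" "\<And>w. w \<in> SigmaA N A \<Longrightarrow> \<exists>w'\<in>R. \<forall>k<m. w k = w' k"
proof -
  \<comment> \<open>The prefix of length \<open>m\<close>. Only finitely many words over
    \<open>{1..N}\<close> occur, and one point is kept for each word that does.\<close>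
  define h where "h w = map w [0..<m]" for w :: "nat \<Rightarrow> nat"
  have "h ` SigmaA N A \<subseteq> {xs. set xs \<subseteq> {1..N} \<and> length xs = m}"
    by (auto simp: h_def SigmaA_def)
  then have "finite (h ` SigmaA N A)"
    by (rule finite_subset) (simp add: finite_lists_length_eq)
  then obtain R where R: "R \<subseteq> SigmaA N A" "finite R" "h ` SigmaA N A = h ` R"
    using finite_subset_image[OF _ subset_refl] by metis
  show thesis
  proof (rule that[OF R(2,1)])
    fix w assume "w \<in> SigmaA N A"
    then obtain w' where "w' \<in> R" "h w = h w'" using R(3) by blast
    then show "\<exists>w'\<in>R. \<forall>k<m. w k = w' k" by (auto simp: h_def)
  qed
qed

text \<open>Arzela-Ascoli, with the bounds \<open>b m\<close> as equicontinuity. A diagonal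
  subsequence converges on the countable union of the prefix nets; a general point is compared with
  a net point \<open>v\<close> sharing a prefix. The comparison runs through \<open>v\<close> and
  the limit \<open>l v\<close> in four pieces, hence \<open>e / 4\<close>.\<close>

lemma uniform_limit_subsequence:
  assumes bdd: "\<And>n w. w \<in> SigmaA N A \<Longrightarrow> cmod (g n w) \<le> a"
    and var: "\<And>n m. var N A m (g n) \<le> ereal (b m)" and b: "b \<longlonglongrightarrow> 0"
  obtains r \<psi> where "strict_mono (r::nat \<Rightarrow> nat)"
    "uniform_limit (SigmaA N A) (\<lambda>n. g (r n)) \<psi> sequentially"
proof -
  have "\<exists>R. finite R \<and> R \<subseteq> SigmaA N A \<and> (\<forall>w\<in>SigmaA N A. \<exists>w'\<in>R. \<forall>k<m. w k = w' k)" for m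
    using finite_prefix_net[of m] by metis
  then obtain R where R: "\<And>m. finite (R m)" "\<And>m. R m \<subseteq> SigmaA N A"
    "\<And>m w. w \<in> SigmaA N A \<Longrightarrow> \<exists>w'\<in>R m. \<forall>k<m. w k = w' k" by metis
  have count: "countable (\<Union>m. R m)" using R(1) by (simp add: countable_finite)
  have "\<And>n w. w \<in> (\<Union>m. R m) \<Longrightarrow> cmod (g n w) \<le> a" using bdd R(2) by blast
  from function_convergent_subsequence[of _ g, OF count this] obtain r where r: "strict_mono (r::nat \<Rightarrow> nat)"
    "\<And>w. w \<in> (\<Union>m. R m) \<Longrightarrow> \<exists>l. (\<lambda>n. g (r n) w) \<longlonglongrightarrow> l"
    by metis
  have "uniformly_Cauchy_on (SigmaA N A) (\<lambda>n. g (r n))"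
    unfolding uniformly_Cauchy_on_def
  proof (intro allI impI)
    fix e :: real assume e: "0 < e"
    obtain m where m: "b m < e / 4"
      using order_tendstoD(2)[OF b, of "e / 4"] e by (auto simp: eventually_sequentially)
    obtain l where l: "\<And>w. w \<in> R m \<Longrightarrow> (\<lambda>n. g (r n) w) \<longlonglongrightarrow> l w" using r(2) by (metis UN_I UNIV_I)
    have "eventually (\<lambda>n. \<forall>w\<in>R m. dist (g (r n) w) (l w) < e / 4) sequentially"
      using tendstoD[OF l, of _ "e / 4"] e by (intro eventually_ball_finite R(1)) simp
    then obtain n0 where n0: "\<And>n w. n \<ge> n0 \<Longrightarrow> w \<in> R m \<Longrightarrow> dist (g (r n) w) (l w) < e / 4"
      by (auto simp: eventually_sequentially)
    show "\<exists>M. \<forall>w\<in>SigmaA N A. \<forall>p\<ge>M. \<forall>q\<ge>M. dist (g (r p) w) (g (r q) w) < e"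
    proof (intro exI ballI allI impI)
      fix w p q assume w: "w \<in> SigmaA N A" and pq: "n0 \<le> p" "n0 \<le> q"
      obtain v where v: "v \<in> R m" "\<forall>k<m. w k = v k" using R(3) w by blast
      have close: "dist (g (r i) w) (g (r i) v) < e / 4" for i
      proof -
        have "v \<in> SigmaA N A" using v(1) R(2) by blast
        then have "cmod (g (r i) w - g (r i) v) \<le> b m" using var[of m "r i"] w v(2) by (simp add: var_le_iff)
        then show ?thesis using m by (simp add: dist_norm)
      qed
      show "dist (g (r p) w) (g (r q) w) < e"
        using close[of p] close[of q] n0[OF pq(1) v(1)] n0[OF pq(2) v(1)]
          dist_triangle[of "g (r p) w" "g (r q) w" "g (r p) v"]
          dist_triangle2[of "g (r p) v" "g (r q) w" "g (r q) v"]
          dist_triangle2[of "g (r p) v" "g (r q) v" "l v"] by linarith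
    qed
  qed
  then obtain \<psi> where "uniform_limit (SigmaA N A) (\<lambda>n. g (r n)) \<psi> sequentially"
    using Cauchy_uniformly_convergent by (auto simp: uniformly_convergent_on_def)
  then show thesis using r(1) that by blast
qed

text \<open>The compact inclusion behind part (i): the gain of a factor \<open>\<eta> m \<rightarrow> 0\<close> in the variations
  upgrades uniform convergence to convergence in \<open>Bnorm\<close>. For the finitely many levels at which
  \<open>\<eta> m\<close> is not yet small the variation is controlled by the sup norm, unless \<open>\<theta> (Suc m) ^ m = 0\<close>,
  in which case it vanishes.\<close>
lemma compact_inclusion:
  assumes ext: "\<And>n. g n \<in> ext_funs N A"
    and bdd: "\<And>n w. w \<in> SigmaA N A \<Longrightarrow> cmod (g n w) \<le> a"
    and var: "\<And>n m. var N A m (g n) \<le> ereal (\<eta> m * \<theta> (Suc m) ^ m)"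
    and \<eta>: "\<eta> \<longlonglongrightarrow> 0"
  obtains r \<psi> where "strict_mono (r::nat \<Rightarrow> nat)" "\<psi> \<in> Bsp N A \<theta>"
    "(\<lambda>n. Bnorm N A \<theta> (\<lambda>w. g (r n) w - \<psi> w)) \<longlonglongrightarrow> 0"
proof -
  have "eventually (\<lambda>m. \<eta> m \<le> 1) sequentially"
    using order_tendstoD(2)[OF \<eta>, of 1] by (auto elim: eventually_mono)
  \<comment> \<open>A uniform bound on \<open>\<eta>\<close> turns the improved variation bounds
    into plain membership in \<open>Bsp\<close>, for each \<open>g n\<close> and for the
    limit.\<close>
  then obtain H where H: "H \<ge> 0" "\<And>m. \<eta> m \<le> H"
    by (rule eventually_bounded_imp_bounded) blast
  obtain D where D: "D \<ge> 0" "\<And>m. \<theta> (Suc m) ^ m \<le> D * 1 ^ m" using \<theta>_power_le_geometric[of 1] by auto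
  have "(\<lambda>m. \<eta> m * \<theta> (Suc m) ^ m) \<longlonglongrightarrow> 0"
  proof (rule Lim_null_comparison)
    show "\<forall>\<^sub>F m in sequentially. norm (\<eta> m * \<theta> (Suc m) ^ m) \<le> \<bar>\<eta> m\<bar> * D"
      using D \<theta>_power_nonneg by (intro always_eventually allI) (auto simp: abs_mult intro!: mult_left_mono)
    show "(\<lambda>m. \<bar>\<eta> m\<bar> * D) \<longlonglongrightarrow> 0" using tendsto_rabs_zero[OF \<eta>] by (rule tendsto_mult_left_zero)
  qed
  from uniform_limit_subsequence[of g a, OF bdd var this]
  obtain r \<psi>0 where r: "strict_mono (r::nat \<Rightarrow> nat)"
    and lim0: "uniform_limit (SigmaA N A) (\<lambda>n. g (r n)) \<psi>0 sequentially" by blast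
  \<comment> \<open>Uniform convergence says nothing off \<open>SigmaA N A\<close>, where members of
    \<open>ext_funs\<close> must vanish.\<close>
  define \<psi> where "\<psi> w = (if w \<in> SigmaA N A then \<psi>0 w else 0)" for w
  have lim: "uniform_limit (SigmaA N A) (\<lambda>n. g (r n)) \<psi> sequentially"
    using lim0 by (subst uniform_limit_cong'[of _ _ "\<lambda>n. g (r n)" _ \<psi>0]) (auto simp: \<psi>_def)
  have var_\<psi>: "var N A m \<psi> \<le> ereal (\<eta> m * \<theta> (Suc m) ^ m)" for m
    unfolding var_le_iff
  proof (intro ballI impI)
    fix w w' assume w: "w \<in> SigmaA N A" "w' \<in> SigmaA N A" "\<forall>k<m. w k = w' k"
    have "(\<lambda>n. cmod (g (r n) w - g (r n) w')) \<longlonglongrightarrow> cmod (\<psi> w - \<psi> w')"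
      using w by (intro tendsto_norm tendsto_diff tendsto_uniform_limitI[OF lim])
    moreover have "cmod (g (r n) w - g (r n) w') \<le> \<eta> m * \<theta> (Suc m) ^ m" for n
      using var w by (simp add: var_le_iff)
    ultimately show "cmod (\<psi> w - \<psi> w') \<le> \<eta> m * \<theta> (Suc m) ^ m" by (intro LIMSEQ_le_const2) auto
  qed
  have in_B: "\<phi> \<in> Bsp N A \<theta>"
    if "\<phi> \<in> ext_funs N A" "\<And>m. var N A m \<phi> \<le> ereal (\<eta> m * \<theta> (Suc m) ^ m)" for \<phi>
  proof (rule BspI[OF that(1) H(1)])
    fix m
    have "\<eta> m * \<theta> (Suc m) ^ m \<le> H * \<theta> (Suc m) ^ m" by (rule mult_right_mono[OF H(2) \<theta>_power_nonneg])
    then show "var N A m \<phi> \<le> ereal (H * \<theta> (Suc m) ^ m)" using that(2)[of m] by (auto intro: order_trans)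
  qed
  have \<psi>: "\<psi> \<in> Bsp N A \<theta>" by (rule in_B[OF _ var_\<psi>]) (simp add: \<psi>_def ext_funs_def)
  have diff_B: "(\<lambda>w. g (r n) w - \<psi> w) \<in> Bsp N A \<theta>" for n
    using Bsp_combination[OF in_B[OF ext var, of "r n"] \<psi>, of 1 "- 1"] by simp
  have "(\<lambda>n. Bnorm N A \<theta> (\<lambda>w. g (r n) w - \<psi> w)) \<longlonglongrightarrow> 0"
  proof (rule tendstoI)
    fix e :: real assume e: "0 < e"
    \<comment> \<open>Both regimes double \<open>e / 8\<close> to \<open>e / 4\<close>: above
      \<open>M\<close> the variations of \<open>g (r n)\<close> and \<open>\<psi>\<close> add up,
      below \<open>M\<close> the sup distance is used at two points. Another \<open>e / 4\<close> is
      left for the sup norm.\<close>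
    obtain M where M: "\<And>m. m \<ge> M \<Longrightarrow> \<eta> m < e / 8"
      using order_tendstoD(2)[OF \<eta>, of "e / 8"] e by (auto simp: eventually_sequentially)
    have "eventually (\<lambda>n. \<forall>m\<in>{..<M}. \<theta> (Suc m) ^ m \<noteq> 0 \<longrightarrow>
        (\<forall>w\<in>SigmaA N A. dist (g (r n) w) (\<psi> w) < e / 8 * \<theta> (Suc m) ^ m)) sequentially"
    proof (intro eventually_ball_finite ballI)
      fix m
      show "eventually (\<lambda>n. \<theta> (Suc m) ^ m \<noteq> 0 \<longrightarrow>
          (\<forall>w\<in>SigmaA N A. dist (g (r n) w) (\<psi> w) < e / 8 * \<theta> (Suc m) ^ m)) sequentially"
      proof (cases "\<theta> (Suc m) ^ m = 0")
        case False
        then have "0 < e / 8 * \<theta> (Suc m) ^ m" using e \<theta>_power_nonneg[of m] by (intro mult_pos_pos) linarith+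
        from uniform_limitD[OF lim this] show ?thesis by (auto elim: eventually_mono)
      qed simp
    qed simp
    moreover have "eventually (\<lambda>n. \<forall>w\<in>SigmaA N A. dist (g (r n) w) (\<psi> w) < e / 4) sequentially"
      using uniform_limitD[OF lim, of "e / 4"] e by simp
    ultimately show "eventually (\<lambda>n. dist (Bnorm N A \<theta> (\<lambda>w. g (r n) w - \<psi> w)) 0 < e) sequentially"
    proof eventually_elim
      case (elim n)
      have "var N A m (\<lambda>w. g (r n) w - \<psi> w) \<le> ereal (e / 4 * \<theta> (Suc m) ^ m)" for m
      proof (cases "m < M \<and> \<theta> (Suc m) ^ m \<noteq> 0")
        case True
        have "cmod ((g (r n) w - \<psi> w) - (g (r n) w' - \<psi> w')) \<le> e / 4 * \<theta> (Suc m) ^ m"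
          if "w \<in> SigmaA N A" "w' \<in> SigmaA N A" for w w'
        proof -
          have "cmod (g (r n) v - \<psi> v) < e / 8 * \<theta> (Suc m) ^ m" if "v \<in> SigmaA N A" for v
            using elim(1) True that by (auto simp: dist_norm)
          from this[OF that(1)] this[OF that(2)] show ?thesis
            using norm_triangle_ineq4[of "g (r n) w - \<psi> w" "g (r n) w' - \<psi> w'"] by simp
        qed
        then show ?thesis by (simp add: var_le_iff)
      next
        case False
        have "2 * \<eta> m * \<theta> (Suc m) ^ m \<le> e / 4 * \<theta> (Suc m) ^ m"
        proof (cases "m < M")
          case True
          then have "\<theta> (Suc m) ^ m = 0" using False by blast
          then show ?thesis by (simp only: mult_zero_right)
        next
          case False
          then show ?thesis using M[of m] by (intro mult_right_mono \<theta>_power_nonneg) simp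
        qed
        moreover have "var N A m (\<lambda>w. g (r n) w - \<psi> w) \<le> ereal (2 * \<eta> m * \<theta> (Suc m) ^ m)"
          using var_combination[OF var[of m "r n"] var_\<psi>, of 1 "- 1"] by (simp add: mult.assoc)
        ultimately show ?thesis by (auto intro: order_trans)
      qed
      then have "Bnorm N A \<theta> (\<lambda>w. g (r n) w - \<psi> w) \<le> e / 4 + e / 4"
        using elim(2) e by (intro Bnorm_le) (auto simp: dist_norm intro: less_imp_le)
      then show ?case using Bnorm_nonneg[OF diff_B, of n] e by (simp add: dist_norm)
    qed
  qed
  then show thesis using r \<psi> that by blast
qed

end

section \<open>The transfer operator on the graded space\<close>

locale transfer_operator = graded_shift_space +
  fixes f :: "(nat \<Rightarrow> nat) \<Rightarrow> complex"
  assumes f_Vsp: "f \<in> Vsp N A"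
    and var_f: "m \<ge> 1 \<Longrightarrow> var N A m f \<le> ereal (\<theta> m ^ m)"
begin

abbreviation L :: "((nat \<Rightarrow> nat) \<Rightarrow> complex) \<Rightarrow> (nat \<Rightarrow> nat) \<Rightarrow> complex" where
  "L \<equiv> transfer N A f"

text \<open>The surplus factor of \<open>\<theta> (Suc m) ^ Suc m\<close> over the weight
  \<open>\<theta> (Suc m) ^ m\<close>. The value 1 at level 0 reflects that only the sup bound is
  available there.\<close>

definition gain :: "nat \<Rightarrow> real" where
  "gain m = (if m = 0 then 1 else \<theta> (Suc m))"

lemma gain_tendsto: "gain \<longlonglongrightarrow> 0"
proof (rule Lim_transform_eventually[OF \<theta>_Suc_tendsto])
  show "eventually (\<lambda>m. \<theta> (Suc m) = gain m) sequentially"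
    using eventually_gt_at_top[of 0] by eventually_elim (simp add: gain_def)
qed

text \<open>\<open>M\<close> is any upper bound of the norm, so that one estimate applies to a whole
  bounded sequence. The factor 2 arises for \<open>m \<ge> 1\<close> from the equal contributions of
  \<open>f\<close> and \<open>\<phi>\<close>, and at level 0 from comparing two values.\<close>

lemma transfer_Bsp_estimates:
  obtains K where "K > 0"
    and "\<And>\<phi> w M. \<phi> \<in> Bsp N A \<theta> \<Longrightarrow> Bnorm N A \<theta> \<phi> \<le> M \<Longrightarrow> w \<in> SigmaA N A \<Longrightarrow> cmod (L \<phi> w) \<le> K * M"
    and "\<And>\<phi> m M. \<phi> \<in> Bsp N A \<theta> \<Longrightarrow> Bnorm N A \<theta> \<phi> \<le> M \<Longrightarrow>
           var N A m (L \<phi>) \<le> ereal (2 * K * M * gain m * \<theta> (Suc m) ^ m)"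
proof -
  obtain K where K: "K > 0"
    "\<And>\<phi> a w. (\<And>w. w \<in> SigmaA N A \<Longrightarrow> cmod (\<phi> w) \<le> a) \<Longrightarrow> w \<in> SigmaA N A \<Longrightarrow> cmod (L \<phi> w) \<le> K * a"
    "\<And>\<phi> a b c m. (\<And>w. w \<in> SigmaA N A \<Longrightarrow> cmod (\<phi> w) \<le> a) \<Longrightarrow> 1 \<le> m \<Longrightarrow>
           var N A (Suc m) f \<le> ereal b \<Longrightarrow> var N A (Suc m) \<phi> \<le> ereal c \<Longrightarrow>
           var N A m (L \<phi>) \<le> ereal (K * (a * b + c))"
    using transfer_estimates[OF f_Vsp] by blast
  have sup: "cmod (\<phi> w) \<le> M"
    if "\<phi> \<in> Bsp N A \<theta>" "Bnorm N A \<theta> \<phi> \<le> M" "w \<in> SigmaA N A" for \<phi> w M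
    using cmod_le_supnorm[OF that(1,3)] seminorm_nonneg[OF that(1)] that(2) by (simp add: Bnorm_eq)
  have 1: "cmod (L \<phi> w) \<le> K * M"
    if "\<phi> \<in> Bsp N A \<theta>" "Bnorm N A \<theta> \<phi> \<le> M" "w \<in> SigmaA N A" for \<phi> w M
    using that by (intro K(2) sup)
  have 2: "var N A m (L \<phi>) \<le> ereal (2 * K * M * gain m * \<theta> (Suc m) ^ m)"
    if \<phi>: "\<phi> \<in> Bsp N A \<theta>" and M: "Bnorm N A \<theta> \<phi> \<le> M" for \<phi> m M
  proof (cases "m = 0")
    case True
    have "cmod (L \<phi> w - L \<phi> w') \<le> 2 * K * M" if "w \<in> SigmaA N A" "w' \<in> SigmaA N A" for w w'
      using norm_triangle_ineq4[of "L \<phi> w" "L \<phi> w'"] 1[OF \<phi> M that(1)] 1[OF \<phi> M that(2)] by linarith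
    then show ?thesis using True by (simp add: var_le_iff gain_def)
  next
    case False
    have sM: "seminorm \<phi> \<le> M" using supnorm_nonneg[OF \<phi>] M by (simp add: Bnorm_eq)
    \<comment> \<open>Membership of \<open>\<phi>\<close> at level \<open>Suc m\<close> comes with
      the base \<open>\<theta> (Suc (Suc m))\<close>; monotonicity replaces it by the base that
      bounds the variation of \<open>f\<close>.\<close>
    have "seminorm \<phi> * \<theta> (Suc (Suc m)) ^ Suc m \<le> M * \<theta> (Suc m) ^ Suc m"
      using sM seminorm_nonneg[OF \<phi>]
      by (intro mult_mono power_mono \<theta>_Suc_le zero_le_power \<theta>_nonneg) auto
    then have "var N A (Suc m) \<phi> \<le> ereal (M * \<theta> (Suc m) ^ Suc m)"
      using var_le_seminorm[OF \<phi>, of "Suc m"] by (auto intro: order_trans)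
    then have "var N A m (L \<phi>) \<le> ereal (K * (M * \<theta> (Suc m) ^ Suc m + M * \<theta> (Suc m) ^ Suc m))"
      using False sup[OF \<phi> M] by (intro K(3) var_f) auto
    then show ?thesis using False by (simp add: gain_def algebra_simps)
  qed
  show thesis by (rule that[OF K(1) 1 2])
qed

text \<open>The image of a bounded sequence satisfies the hypotheses of
  \<open>compact_inclusion\<close> with \<open>\<eta> m = 2 * K * M * gain m\<close>.\<close>

lemma compact_operator_transfer:
  "compact_operator (\<lambda>(c::complex) \<phi> w. c * \<phi> w) (Bsp N A \<theta>) (Bnorm N A \<theta>) L"
proof -
  interpret B: normed_subspace "\<lambda>(c::complex) \<phi> w. c * \<phi> w" "Bsp N A \<theta>" "Bnorm N A \<theta>"
    by (rule normed_subspace_Bsp)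
  obtain K where K: "K > 0"
    "\<And>\<phi> w M. \<phi> \<in> Bsp N A \<theta> \<Longrightarrow> Bnorm N A \<theta> \<phi> \<le> M \<Longrightarrow> w \<in> SigmaA N A \<Longrightarrow> cmod (L \<phi> w) \<le> K * M"
    "\<And>\<phi> m M. \<phi> \<in> Bsp N A \<theta> \<Longrightarrow> Bnorm N A \<theta> \<phi> \<le> M \<Longrightarrow>
       var N A m (L \<phi>) \<le> ereal (2 * K * M * gain m * \<theta> (Suc m) ^ m)"
    using transfer_Bsp_estimates by blast
  have lim: "(\<lambda>m. 2 * K * M * gain m) \<longlonglongrightarrow> 0" for M
    using tendsto_mult_right_zero[OF gain_tendsto] .
  have compact: "\<exists>r \<psi>. strict_mono (r::nat \<Rightarrow> nat) \<and> \<psi> \<in> Bsp N A \<theta> \<and>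
      (\<lambda>n. Bnorm N A \<theta> (\<lambda>w. L (s (r n)) w - \<psi> w)) \<longlonglongrightarrow> 0"
    if s: "\<And>n::nat. s n \<in> Bsp N A \<theta>" "\<And>n. Bnorm N A \<theta> (s n) \<le> M" for s :: "nat \<Rightarrow> (nat \<Rightarrow> nat) \<Rightarrow> complex" and M
  proof -
    have "cmod (L (s n) w) \<le> K * M" if "w \<in> SigmaA N A" for n w using K(2)[OF s that] .
    moreover have "var N A m (L (s n)) \<le> ereal (2 * K * M * gain m * \<theta> (Suc m) ^ m)" for n m
      using K(3)[OF s] .
    ultimately show ?thesis
      by (rule compact_inclusion[of "\<lambda>n. L (s n)", OF transfer_in_ext_funs _ _ lim])
        (assumption | intro exI conjI)+
  qed
  show ?thesis
  proof
    fix \<phi> assume \<phi>: "\<phi> \<in> Bsp N A \<theta>"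
    have "eventually (\<lambda>m. 2 * K * Bnorm N A \<theta> \<phi> * gain m \<le> 1) sequentially"
      using order_tendstoD(2)[OF lim[of "Bnorm N A \<theta> \<phi>"], of 1] by (auto elim: eventually_mono)
    then obtain D where D: "D \<ge> 0" "\<And>m. 2 * K * Bnorm N A \<theta> \<phi> * gain m \<le> D"
      by (rule eventually_bounded_imp_bounded) blast
    show "L \<phi> \<in> Bsp N A \<theta>"
    proof (rule BspI[OF transfer_in_ext_funs D(1)])
      fix m
      show "var N A m (L \<phi>) \<le> ereal (D * \<theta> (Suc m) ^ m)"
        using K(3)[OF \<phi> order_refl, of m] mult_right_mono[OF D(2)[of m] \<theta>_power_nonneg[of m]]
        by (auto intro: order_trans)
    qed
  next
    fix \<phi> \<psi> assume "\<phi> \<in> Bsp N A \<theta>" "\<psi> \<in> Bsp N A \<theta>"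
    show "L (\<phi> + \<psi>) = L \<phi> + L \<psi>"
      using transfer_linear[of f 1 \<phi> 1 \<psi>] by (simp add: plus_fun_def)
  next
    fix c and \<phi> assume "\<phi> \<in> Bsp N A \<theta>"
    show "L (\<lambda>w. c * \<phi> w) = (\<lambda>w. c * L \<phi> w)"
      using transfer_linear[of f c \<phi> 0 \<phi>] by simp
  next
    fix s :: "nat \<Rightarrow> (nat \<Rightarrow> nat) \<Rightarrow> complex" and M assume "\<And>n. s n \<in> Bsp N A \<theta>" "\<And>n. Bnorm N A \<theta> (s n) \<le> M"
    from compact[OF this]
    show "\<exists>r y. strict_mono (r::nat \<Rightarrow> nat) \<and> y \<in> Bsp N A \<theta> \<and> (\<lambda>n. Bnorm N A \<theta> (L (s (r n)) - y)) \<longlonglongrightarrow> 0"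
      by (simp add: fun_diff_def)
  qed
qed

sublocale B: compact_operator "\<lambda>(c::complex) \<phi> w. c * \<phi> w" "Bsp N A \<theta>" "Bnorm N A \<theta>" L
  by (rule compact_operator_transfer)

text \<open>Since \<open>l * \<psi> = L \<psi> - \<chi>\<close> and \<open>L\<close> shifts the variations by one, \<open>v m \<le> D * \<theta> (Suc m) ^ m + q * v (Suc m)\<close>
  for \<open>v m = var\<^sub>m \<psi>\<close>. Iterating this, the remainder \<open>q ^ J * v (m + J)\<close> vanishes because \<open>\<psi>\<close> is super-continuous.\<close>
lemma resolvent_regularity:
  assumes l: "l \<noteq> 0" and \<psi>: "\<psi> \<in> Vsp N A" and \<chi>: "(\<lambda>w. L \<psi> w - l * \<psi> w) \<in> Bsp N A \<theta>"
  shows "\<psi> \<in> Bsp N A \<theta>"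
proof -
  define \<xi> where "\<xi> = (\<lambda>w. L \<psi> w - l * \<psi> w)"
  obtain c where c: "c \<ge> 0" "\<And>m. var N A m \<xi> \<le> ereal (c * \<theta> (Suc m) ^ m)"
    using \<chi>[folded \<xi>_def] by (auto simp: Bsp_iff)
  obtain K where K: "K > 0"
    "\<And>\<phi> a w. (\<And>w. w \<in> SigmaA N A \<Longrightarrow> cmod (\<phi> w) \<le> a) \<Longrightarrow> w \<in> SigmaA N A \<Longrightarrow> cmod (L \<phi> w) \<le> K * a"
    "\<And>\<phi> a b c m. (\<And>w. w \<in> SigmaA N A \<Longrightarrow> cmod (\<phi> w) \<le> a) \<Longrightarrow> 1 \<le> m \<Longrightarrow>
           var N A (Suc m) f \<le> ereal b \<Longrightarrow> var N A (Suc m) \<phi> \<le> ereal c \<Longrightarrow>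
           var N A m (L \<phi>) \<le> ereal (K * (a * b + c))"
    using transfer_estimates[OF f_Vsp] by blast
  obtain a where a: "a \<ge> 0" "\<And>w. w \<in> SigmaA N A \<Longrightarrow> cmod (\<psi> w) \<le> a" using Vsp_bounded[OF \<psi>] by blast
  define v where "v m = real_of_ereal (var N A m \<psi>)" for m
  have v: "var N A m \<psi> = ereal (v m)" for m
    using \<psi> ereal_real_var[of m \<psi>, symmetric] by (simp only: v_def Vsp_def mem_Collect_eq simp_thms)
  define q where "q = K / cmod l"
  \<comment> \<open>The variation of \<open>f\<close> contributes
    \<open>K * a * \<theta> (Suc m) ^ Suc m\<close>; one of its factors is bounded by
    \<open>\<theta> 1\<close>, leaving the weight \<open>\<theta> (Suc m) ^ m\<close>. The term
    \<open>c\<close> comes from the right-hand side \<open>\<xi>\<close>.\<close>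
  define D where "D = (K * a * \<theta> 1 + c) / cmod l"
  have q: "q > 0" using K l by (simp add: q_def)
  have D: "D \<ge> 0" using K a c \<theta>_nonneg[of 1] by (simp add: D_def)
  have step: "v m \<le> D * \<theta> (Suc m) ^ m + q * v (Suc m)" if m: "1 \<le> m" for m
  proof -
    have "var N A m (L \<psi>) \<le> ereal (K * (a * \<theta> (Suc m) ^ Suc m + v (Suc m)))"
      using m by (intro K(3) a(2) var_f) (auto simp: v)
    from var_combination[OF this c(2), of "inverse l" "- inverse l"]
    have "var N A m \<psi> \<le> ereal (cmod (inverse l) * (K * (a * \<theta> (Suc m) ^ Suc m + v (Suc m)))
        + cmod (- inverse l) * (c * \<theta> (Suc m) ^ m))"
      using l by (simp add: \<xi>_def algebra_simps)
    then have "v m \<le> (K * a * \<theta> (Suc m) + c) / cmod l * \<theta> (Suc m) ^ m + q * v (Suc m)"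
      by (simp add: v q_def norm_inverse divide_inverse algebra_simps)
    also have "\<dots> \<le> D * \<theta> (Suc m) ^ m + q * v (Suc m)"
      using \<theta>_antimono[of 1 "Suc m"] K a \<theta>_power_nonneg[of m]
      by (auto simp: D_def intro!: add_right_mono mult_right_mono divide_right_mono mult_left_mono)
    finally show ?thesis .
  qed
  \<comment> \<open>The weight at level \<open>m + J\<close> splits by monotonicity into the weight
    at level \<open>m\<close> and a factor that, combined with \<open>q ^ J\<close>, is a term of a
    series independent of \<open>m\<close>.\<close>
  have iter: "v m \<le> D * (\<Sum>j<J. (q * \<theta> (Suc j)) ^ j) * \<theta> (Suc m) ^ m + q ^ J * v (m + J)"
    if m: "1 \<le> m" for m J
  proof (induction J)
    case (Suc J)
    have "\<theta> (Suc (m + J)) ^ (m + J) \<le> \<theta> (Suc m) ^ m * \<theta> (Suc J) ^ J"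
      unfolding power_add
      by (intro mult_mono power_mono \<theta>_antimono zero_le_power \<theta>_nonneg) auto
    then have "D * \<theta> (Suc (m + J)) ^ (m + J) \<le> D * (\<theta> (Suc m) ^ m * \<theta> (Suc J) ^ J)"
      using D by (rule mult_left_mono)
    with step[of "m + J"] m
    have "v (m + J) \<le> D * (\<theta> (Suc m) ^ m * \<theta> (Suc J) ^ J) + q * v (Suc (m + J))" by simp
    then have "q ^ J * v (m + J) \<le> q ^ J * (D * (\<theta> (Suc m) ^ m * \<theta> (Suc J) ^ J) + q * v (Suc (m + J)))"
      using q by (intro mult_left_mono) auto
    also have "\<dots> = D * (q * \<theta> (Suc J)) ^ J * \<theta> (Suc m) ^ m + q ^ Suc J * v (m + Suc J)"
      by (simp add: algebra_simps power_mult_distrib)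
    finally show ?case using Suc by (simp add: algebra_simps)
  qed simp
  \<comment> \<open>Beyond some index \<open>q * \<theta> (Suc j)\<close> is at most 1/2, however
    large \<open>q\<close> is.\<close>
  have "summable (\<lambda>j. (q * \<theta> (Suc j)) ^ j)"
  proof (rule summable_comparison_test_ev)
    show "eventually (\<lambda>j. norm ((q * \<theta> (Suc j)) ^ j) \<le> (1/2) ^ j) sequentially"
      using eventually_mult_\<theta>_le[of "1/2" q, simplified]
    proof eventually_elim
      case (elim j)
      have "0 \<le> q * \<theta> (Suc j)" using q \<theta>_nonneg[of "Suc j"] by simp
      moreover from this elim have "(q * \<theta> (Suc j)) ^ j \<le> (1/2) ^ j" by (intro power_mono) auto
      ultimately show ?case by (simp only: real_norm_def abs_of_nonneg zero_le_power)
    qed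
  qed (simp add: summable_geometric)
  then have sum_le: "(\<Sum>j<J. (q * \<theta> (Suc j)) ^ j) \<le> (\<Sum>j. (q * \<theta> (Suc j)) ^ j)" for J
    using q by (intro sum_le_suminf) (auto intro!: zero_le_power mult_nonneg_nonneg \<theta>_nonneg simp del: power_mult_distrib zero_le_power_eq)
  define S where "S = (\<Sum>j. (q * \<theta> (Suc j)) ^ j)"
  have S: "S \<ge> 0" using sum_le[of 0] by (simp add: S_def)
  \<comment> \<open>Super-continuity at the rate \<open>1 / (2 * q)\<close> beats the growth of
    \<open>q ^ J\<close> and leaves \<open>(1/2) ^ J\<close> in the remainder.\<close>
  have "0 < 1 / (2 * q)" using q by simp
  then obtain C where C: "C \<ge> 0" "\<And>m. var N A m \<psi> \<le> ereal (C * (1 / (2 * q)) ^ m)"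
    using \<psi> unfolding Vsp_iff by meson
  have v_le: "v m \<le> D * S * \<theta> (Suc m) ^ m" if m: "1 \<le> m" for m
  proof (rule LIMSEQ_le_const)
    have "v m \<le> D * S * \<theta> (Suc m) ^ m + C * (1 / (2 * q)) ^ m * (1/2) ^ J" for J
    proof -
      have "q ^ J * v (m + J) \<le> q ^ J * (C * (1 / (2 * q)) ^ (m + J))"
        using C(2)[of "m + J"] q by (intro mult_left_mono) (auto simp: v)
      also have "\<dots> = C * (1 / (2 * q)) ^ m * (1/2) ^ J"
        using q by (simp add: power_add power_divide power_mult_distrib)
      finally have "q ^ J * v (m + J) \<le> C * (1 / (2 * q)) ^ m * (1/2) ^ J" .
      moreover have "D * (\<Sum>j<J. (q * \<theta> (Suc j)) ^ j) * \<theta> (Suc m) ^ m \<le> D * S * \<theta> (Suc m) ^ m"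
        using sum_le D \<theta>_power_nonneg unfolding S_def by (intro mult_right_mono mult_left_mono)
      ultimately show ?thesis using iter[OF m, of J] by linarith
    qed
    then show "\<exists>N. \<forall>J\<ge>N. v m \<le> D * S * \<theta> (Suc m) ^ m + C * (1 / (2 * q)) ^ m * (1/2) ^ J" by blast
    have "(\<lambda>J. D * S * \<theta> (Suc m) ^ m + C * (1 / (2 * q)) ^ m * (1/2) ^ J)
        \<longlonglongrightarrow> D * S * \<theta> (Suc m) ^ m + C * (1 / (2 * q)) ^ m * 0"
      by (intro tendsto_intros LIMSEQ_power_zero) auto
    then show "(\<lambda>J. D * S * \<theta> (Suc m) ^ m + C * (1 / (2 * q)) ^ m * (1/2) ^ J) \<longlonglongrightarrow> D * S * \<theta> (Suc m) ^ m"
      by simp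
  qed
  show ?thesis
  proof (rule BspI)
    show "\<psi> \<in> ext_funs N A" using \<psi> by (simp add: Vsp_def)
    \<comment> \<open>The recursion starts at level 1. At level 0 the weight is 1, so adding
      \<open>v 0\<close> to the constant suffices.\<close>
    show "0 \<le> v 0 + D * S" using D S by (simp add: v_def real_var_nonneg)
    fix m
    have "0 \<le> v 0" by (simp add: v_def real_var_nonneg)
    then show "var N A m \<psi> \<le> ereal ((v 0 + D * S) * \<theta> (Suc m) ^ m)"
      using v_le[of m] D S \<theta>_power_nonneg[of m]
      by (cases "m = 0") (auto simp: v distrib_right intro: order_trans)
  qed
qed

text \<open>Induction on the nilpotency exponent: if \<open>(P ^^ Suc k) \<phi>\<close> vanishes,
  then \<open>P \<phi>\<close> is in \<open>Bsp\<close> by induction, and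
  \<open>resolvent_regularity\<close> lifts this to \<open>\<phi>\<close>.\<close>

lemma gen_eigenspace_eq:
  assumes l: "l \<noteq> 0"
  shows "gen_eigenspace (Vsp N A) L l = gen_eigenspace (Bsp N A \<theta>) L l"
proof -
  define P where "P = (\<lambda>\<psi> w. L \<psi> w - l * \<psi> w)"
  have P_Vsp: "P \<phi> \<in> Vsp N A" if "\<phi> \<in> Vsp N A" for \<phi>
    using Vsp_combination[OF transfer_Vsp[OF f_Vsp that] that, of 1 "- l"] by (simp add: P_def)
  have "\<phi> \<in> Bsp N A \<theta>" if "\<phi> \<in> Vsp N A" "(P ^^ k) \<phi> = (\<lambda>w. 0)" for \<phi> k
    using that
  proof (induction k arbitrary: \<phi>)
    case 0
    then show ?case using Bsp_zero by simp
  next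
    case (Suc k)
    then have "(P ^^ k) (P \<phi>) = (\<lambda>w. 0)" by (simp add: funpow_swap1)
    then have "P \<phi> \<in> Bsp N A \<theta>" using Suc P_Vsp by blast
    then show ?case using resolvent_regularity[OF l Suc.prems(1)] by (simp add: P_def)
  qed
  then show ?thesis unfolding gen_eigenspace_def P_def[symmetric] using Bsp_imp_Vsp by blast
qed

lemma compact_on_B_transfer: "compact_on_B N A \<theta> L"
  unfolding compact_on_B_def
proof (intro conjI ballI allI impI transfer_linear)
  fix s :: "nat \<Rightarrow> (nat \<Rightarrow> nat) \<Rightarrow> complex"
  assume s: "\<forall>n. s n \<in> Bsp N A \<theta>" "\<exists>M. \<forall>n. Bnorm N A \<theta> (s n) \<le> M"
  then obtain M where "\<And>n. Bnorm N A \<theta> (s n) \<le> M" by blast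
  with B.T_compact[of s M] s(1)
  show "\<exists>r \<psi>. strict_mono r \<and> \<psi> \<in> Bsp N A \<theta> \<and> (\<lambda>n. Bnorm N A \<theta> (\<lambda>w. L (s (r n)) w - \<psi> w)) \<longlonglongrightarrow> 0"
    by (simp add: fun_diff_def)
qed simp

text \<open>An eigenfunction in \<open>Vsp\<close> lies in \<open>Bsp\<close> by
  \<open>resolvent_regularity\<close> with right-hand side 0, and a linear left inverse would send 0
  to it. Conversely, if \<open>l\<close> is no eigenvalue on \<open>Vsp\<close>, then
  \<open>L - l\<close> is injective on the smaller space \<open>Bsp\<close>, and the Fredholm
  alternative supplies a bounded inverse.\<close>

lemma Lambda_f_eq_spectrum: "Lambda_f N A f = spectrum_on_B N A \<theta> L - {0}"
proof (intro equalityI subsetI)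
  fix l assume "l \<in> Lambda_f N A f"
  then obtain \<phi> where l: "l \<noteq> 0" and \<phi>: "\<phi> \<in> Vsp N A" "\<phi> \<noteq> (\<lambda>w. 0)" "L \<phi> = (\<lambda>w. l * \<phi> w)"
    by (auto simp: Lambda_f_def)
  have zero: "(\<lambda>w. L \<phi> w - l * \<phi> w) = (\<lambda>w. 0)" by (simp add: \<phi>(3))
  then have \<phi>B: "\<phi> \<in> Bsp N A \<theta>" using resolvent_regularity[OF l \<phi>(1)] Bsp_zero by simp
  have False
    if R: "\<forall>\<phi>\<in>Bsp N A \<theta>. \<forall>\<psi>\<in>Bsp N A \<theta>. \<forall>a b. R (\<lambda>w. a * \<phi> w + b * \<psi> w) = (\<lambda>w. a * R \<phi> w + b * R \<psi> w)"
      "\<forall>\<phi>\<in>Bsp N A \<theta>. R (\<lambda>w. L \<phi> w - l * \<phi> w) = \<phi>" for R :: "((nat \<Rightarrow> nat) \<Rightarrow> complex) \<Rightarrow> (nat \<Rightarrow> nat) \<Rightarrow> complex"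
  proof -
    have "R (\<lambda>w. 0 * \<phi> w + 0 * \<phi> w) = (\<lambda>w. 0 * R \<phi> w + 0 * R \<phi> w)" using R(1) \<phi>B by blast
    then have "R (\<lambda>w. 0) = (\<lambda>w. 0)" by simp
    moreover have "R (\<lambda>w. 0) = \<phi>" using R(2) \<phi>B zero by fastforce
    ultimately show False using \<phi>(2) by simp
  qed
  then have "l \<in> spectrum_on_B N A \<theta> L" unfolding spectrum_on_B_def by blast
  then show "l \<in> spectrum_on_B N A \<theta> L - {0}" using l by simp
next
  fix l assume "l \<in> spectrum_on_B N A \<theta> L - {0}"
  then have l: "l \<noteq> 0" and spec: "l \<in> spectrum_on_B N A \<theta> L" by auto
  show "l \<in> Lambda_f N A f"
  proof (rule ccontr)
    assume not_in: "l \<notin> Lambda_f N A f"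
    have inj: "\<phi> = 0" if "\<phi> \<in> Bsp N A \<theta>" "B.S l \<phi> = 0" for \<phi>
    proof (rule ccontr)
      assume "\<phi> \<noteq> 0"
      moreover have "L \<phi> = (\<lambda>w. l * \<phi> w)" using that(2) by (simp add: B.S_def[OF l])
      ultimately show False using not_in l Bsp_imp_Vsp[OF that(1)]
        by (auto simp: Lambda_f_def zero_fun_def)
    qed
    obtain R C where R: "\<And>\<phi>. \<phi> \<in> Bsp N A \<theta> \<Longrightarrow> R \<phi> \<in> Bsp N A \<theta>"
      "\<And>\<phi> \<psi> a b. \<phi> \<in> Bsp N A \<theta> \<Longrightarrow> \<psi> \<in> Bsp N A \<theta> \<Longrightarrow>
         R ((\<lambda>w. a * \<phi> w) + (\<lambda>w. b * \<psi> w)) = (\<lambda>w. a * R \<phi> w) + (\<lambda>w. b * R \<psi> w)"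
      "\<And>\<phi>. \<phi> \<in> Bsp N A \<theta> \<Longrightarrow> Bnorm N A \<theta> (R \<phi>) \<le> C * Bnorm N A \<theta> \<phi>"
      "\<And>\<phi>. \<phi> \<in> Bsp N A \<theta> \<Longrightarrow> R (L \<phi> - (\<lambda>w. l * \<phi> w)) = \<phi>"
      "\<And>\<phi>. \<phi> \<in> Bsp N A \<theta> \<Longrightarrow> L (R \<phi>) - (\<lambda>w. l * R \<phi> w) = \<phi>"
      by (rule B.Fredholm_alternative[OF l inj]) blast+
    have "l \<notin> spectrum_on_B N A \<theta> L"
      unfolding spectrum_on_B_def mem_Collect_eq not_not
    proof (intro exI[of _ R] conjI exI[of _ C] ballI allI)
      fix \<phi> \<psi> a b assume "\<phi> \<in> Bsp N A \<theta>" "\<psi> \<in> Bsp N A \<theta>"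
      from R(2)[OF this] show "R (\<lambda>w. a * \<phi> w + b * \<psi> w) = (\<lambda>w. a * R \<phi> w + b * R \<psi> w)"
        by (simp add: plus_fun_def)
    next
      fix \<phi> assume \<phi>: "\<phi> \<in> Bsp N A \<theta>"
      show "R (\<lambda>w. L \<phi> w - l * \<phi> w) = \<phi>" using R(4)[OF \<phi>] by (simp add: fun_diff_def)
      show "(\<lambda>w. L (R \<phi>) w - l * R \<phi> w) = \<phi>" using R(5)[OF \<phi>] by (simp add: fun_diff_def)
    qed (use R(1,3) in auto)
    then show False using spec by simp
  qed
qed

end

section \<open>Points of the shift space from aperiodicity\<close>

lemma matpow_pos_imp_successor:
  "matpow N A k i j > 0 \<Longrightarrow> 1 \<le> k \<Longrightarrow> j \<in> {1..N} \<Longrightarrow> \<exists>l\<in>{1..N}. A i l > 0"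
proof (induction k arbitrary: j)
  case (Suc k)
  have "\<exists>l\<in>{1..N}. 0 < matpow N A k i l * A l j"
  proof (rule ccontr)
    assume "\<not> ?thesis"
    then have "(\<Sum>l\<in>{1..N}. matpow N A k i l * A l j) = 0" by (intro sum.neutral ballI) auto
    then show False using Suc.prems(1) by (simp only: matpow.simps less_irrefl)
  qed
  then obtain l where l: "l \<in> {1..N}" "0 < matpow N A k i l" "0 < A l j" by auto
  \<comment> \<open>\<open>matpow\<close> multiplies by \<open>A\<close> on the right, so the first
    step of a path out of \<open>i\<close> surfaces only at \<open>k = 0\<close>, where the identity
    matrix gives \<open>i = l\<close>.\<close>
  show ?case
  proof (cases "k = 0")
    case True
    then have "i = l" using l(2) by (simp split: if_splits)
    then show ?thesis using l(3) Suc.prems(3) by blast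
  next
    case False
    then show ?thesis using Suc.IH[OF l(2) _ l(1)] by simp
  qed
qed simp

text \<open>A positive diagonal entry of a power of \<open>A\<close> gives each symbol a successor;
  iterating a choice of successors from the symbol 1 produces an admissible sequence.\<close>

lemma SigmaA_nonempty:
  assumes N: "N \<ge> 1" and A: "zero_one_matrix N A" "aperiodic N A"
  shows "SigmaA N A \<noteq> {}"
proof -
  have "\<exists>l\<in>{1..N}. A i l = 1" if i: "i \<in> {1..N}" for i
  proof -
    obtain k where "k \<ge> 1" "matpow N A k i i > 0" using A(2) i by (auto simp: aperiodic_def)
    then obtain l where "l \<in> {1..N}" "A i l > 0" using matpow_pos_imp_successor i by blast
    moreover from this have "A i l = 0 \<or> A i l = 1" using A(1) i unfolding zero_one_matrix_def by blast
    ultimately show ?thesis by auto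
  qed
  then obtain s where s: "\<And>i. i \<in> {1..N} \<Longrightarrow> s i \<in> {1..N} \<and> A i (s i) = 1" by metis
  have "(s ^^ m) 1 \<in> {1..N}" for m by (induction m) (use N s in auto)
  then have "(\<lambda>m. (s ^^ m) 1) \<in> SigmaA N A" using s by (simp add: SigmaA_def)
  then show ?thesis by blast
qed

theorem theorem1p1:
  fixes N :: nat and A :: "nat \<Rightarrow> nat \<Rightarrow> nat"
    and f :: "(nat \<Rightarrow> nat) \<Rightarrow> complex" and \<theta> :: "nat \<Rightarrow> real"
  assumes "N \<ge> 2"
    and "zero_one_matrix N A"
    and "aperiodic N A"
    and "f \<in> Vsp N A"
    and "\<And>m. m \<ge> 1 \<Longrightarrow> \<theta> (Suc m) \<le> \<theta> m"
    and "\<And>m. m \<ge> 1 \<Longrightarrow> \<theta> m \<ge> 0"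
    and "\<theta> \<longlonglongrightarrow> 0"
    and "\<And>m. m \<ge> 1 \<Longrightarrow> root m (real_of_ereal (var N A m f)) \<le> \<theta> m"
  shows "(\<forall>\<phi>\<in>Bsp N A \<theta>. transfer N A f \<phi> \<in> Bsp N A \<theta>)
       \<and> compact_on_B N A \<theta> (transfer N A f)
       \<and> Lambda_f N A f = spectrum_on_B N A \<theta> (transfer N A f) - {0}
       \<and> (\<forall>l\<in>Lambda_f N A f.
            eig_mult (Vsp N A) (transfer N A f) l = eig_mult (Bsp N A \<theta>) (transfer N A f) l)"
proof -
  interpret shift_space N A
    using assms(1-3) by unfold_locales (intro SigmaA_nonempty; simp)
  have var_f: "var N A m f \<le> ereal (\<theta> m ^ m)" if m: "m \<ge> 1" for m
  proof -
    have "real_of_ereal (var N A m f) = root m (real_of_ereal (var N A m f)) ^ m"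
      using m real_var_nonneg by simp
    also have "\<dots> \<le> \<theta> m ^ m"
      using assms(8)[OF m] m real_var_nonneg by (intro power_mono) auto
    finally have "real_of_ereal (var N A m f) \<le> \<theta> m ^ m" .
    \<comment> \<open>\<open>real_of_ereal\<close> maps infinity to 0, so the real inequality says
      something about \<open>var\<close> only together with finiteness.\<close>
    moreover have "var N A m f \<noteq> \<infinity>" using assms(4) by (simp add: Vsp_def)
    ultimately show ?thesis by (metis ereal_real_var ereal_less_eq(3))
  qed
  interpret transfer_operator N A \<theta> f
    using assms(4-7) var_f by unfold_locales
  show ?thesis
  proof (intro conjI ballI)
    fix l assume "l \<in> Lambda_f N A f"
    then have "l \<noteq> 0" by (simp add: Lambda_f_def)
    then show "eig_mult (Vsp N A) L l = eig_mult (Bsp N A \<theta>) L l"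
      by (simp add: eig_mult_def gen_eigenspace_eq)
  qed (simp_all add: compact_on_B_transfer Lambda_f_eq_spectrum)
qed

end
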